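(* Let $G=(V,E)$ be an undirected graph with $n$ vertices and maximum degree $d$ (a constant). Then there is an $(O(\log^3 n),O(\log^3 n),1/n)$-local computation algorithm which, on input an edge $e$, decides if $e$ is in a maximal matching. Moreover, the algorithm gives a consistent maximal matching for every edge in $G$.
   Context: A matching is a set of edges no two of which share a vertex; it is maximal if no further edge can be added while keeping it a matching. A $(t(n),s(n),\delta(n))$-local computation algorithm for a search problem is a randomized algorithm with access to the input and a random tape (in the RAM word model) which answers queries to parts of some valid solution: with probability at least $1-\delta(n)$ all answers to any sequence of queries are consistent with a single valid solution (here, a single maximal matching), each query takes time at most $t(n)$, and the local memory is at most $s(n)$. Logarithms are base 2. *)

theory Defs
  imports "HOL-Probability.Probability" "HOL-Library.Log_Nat" "HOL-Library.Landau_Symbols"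
begin

section \<open>Graphs and matchings\<close>

definition simple_graph :: "'a set \<Rightarrow> 'a set set \<Rightarrow> bool" where
  "simple_graph V E \<longleftrightarrow> finite V \<and> (\<forall>e\<in>E. e \<subseteq> V \<and> card e = 2)"

definition degree :: "'a set set \<Rightarrow> 'a \<Rightarrow> nat" where
  "degree E v = card {e \<in> E. v \<in> e}"

definition max_degree :: "'a set \<Rightarrow> 'a set set \<Rightarrow> nat" where
  "max_degree V E = Max (degree E ` V)"

definition matching :: "'a set set \<Rightarrow> 'a set set \<Rightarrow> bool" where
  "matching E M \<longleftrightarrow> M \<subseteq> E \<and> (\<forall>e\<in>M. \<forall>f\<in>M. e \<noteq> f \<longrightarrow> e \<inter> f = {})"

definition maximal_matching :: "'a set set \<Rightarrow> 'a set set \<Rightarrow> bool" where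
  "maximal_matching E M \<longleftrightarrow> matching E M \<and> (\<forall>e \<in> E - M. \<not> matching E (insert e M))"


section \<open>A word RAM with read-only input and random tape\<close>

text \<open>
  Machine words are the natural numbers below \<open>2 ^ w\<close>, where \<open>w\<close> is the word size. There are no
  registers: all operands are cells of the local memory, so that everything the
  machine stores is charged to it. Every instruction takes one unit of time.
\<close>

datatype binop =
  Add | Sub | Mul | Div | Mod | And | Or | Xor | Shl | Shr | Lt | Eq

fun apply_op :: "nat \<Rightarrow> binop \<Rightarrow> nat \<Rightarrow> nat \<Rightarrow> nat" where
  "apply_op w Add a b = (a + b) mod 2 ^ w"
| "apply_op w Sub a b = (a + 2 ^ w - b) mod 2 ^ w"
| "apply_op w Mul a b = (a * b) mod 2 ^ w"
| "apply_op w Div a b = a div b"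
| "apply_op w Mod a b = a mod b"
| "apply_op w And a b = Bit_Operations.and a b"
| "apply_op w Or a b = Bit_Operations.or a b"
| "apply_op w Xor a b = Bit_Operations.xor a b"
| "apply_op w Shl a b = push_bit b a mod 2 ^ w"
| "apply_op w Shr a b = drop_bit b a"
| "apply_op w Lt a b = of_bool (a < b)"
| "apply_op w Eq a b = of_bool (a = b)"

text \<open>
  With \<open>M\<close>, \<open>X\<close>, \<open>R\<close> the local memory, the input and the random tape:
  \<^item> \<open>Const i k\<close>: \<open>M[i] := k\<close>
  \<^item> \<open>Op f i j k\<close>: \<open>M[i] := f (M[j]) (M[k])\<close>
  \<^item> \<open>Load i j\<close>: \<open>M[i] := M[M[j]]\<close>
  \<^item> \<open>Store i j\<close>: \<open>M[M[i]] := M[j]\<close>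
  \<^item> \<open>Input i j\<close>: \<open>M[i] := X[M[j]]\<close>
  \<^item> \<open>Random i j\<close>: \<open>M[i] := R[M[j]]\<close>
  \<^item> \<open>Jz i l\<close>: if \<open>M[i] = 0\<close> then go to instruction \<open>l\<close>
\<close>

datatype instr =
    Const nat nat
  | Op binop nat nat nat
  | Load nat nat
  | Store nat nat
  | Input nat nat
  | Random nat nat
  | Jz nat nat
  | Halt

type_synonym mem = "nat \<Rightarrow> nat"
type_synonym config = "nat \<times> mem"

fun touched :: "instr \<Rightarrow> mem \<Rightarrow> nat set" where
  "touched (Const i k) M = {i}"
| "touched (Op f i j k) M = {i, j, k}"
| "touched (Load i j) M = {i, j, M j}"
| "touched (Store i j) M = {i, j, M i}"
| "touched (Input i j) M = {i, j}"
| "touched (Random i j) M = {i, j}"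
| "touched (Jz i l) M = {i}"
| "touched Halt M = {}"

fun exec :: "nat \<Rightarrow> nat list \<Rightarrow> (nat \<Rightarrow> nat) \<Rightarrow> instr \<Rightarrow> config \<Rightarrow> config" where
  "exec w X R (Const i k) (pc, M) = (Suc pc, M(i := k mod 2 ^ w))"
| "exec w X R (Op f i j k) (pc, M) = (Suc pc, M(i := apply_op w f (M j) (M k)))"
| "exec w X R (Load i j) (pc, M) = (Suc pc, M(i := M (M j)))"
| "exec w X R (Store i j) (pc, M) = (Suc pc, M(M i := M j))"
| "exec w X R (Input i j) (pc, M) =
     (Suc pc, M(i := (if M j < length X then X ! M j else 0)))"
| "exec w X R (Random i j) (pc, M) = (Suc pc, M(i := R (M j)))"
| "exec w X R (Jz i l) (pc, M) = (if M i = 0 then l else Suc pc, M)"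
| "exec w X R Halt (pc, M) = (pc, M)"

text \<open>
  \<open>run p w S X R T c\<close> is the final memory if program \<open>p\<close>, started in \<open>c\<close>, reaches a
  \<open>Halt\<close> instruction after at most \<open>T\<close> steps, having accessed only the first \<open>S\<close> cells of the
  local memory. It is \<open>None\<close> if the time runs out, a cell outside the
  local memory is accessed, or control leaves the program.
\<close>

fun run :: "instr list \<Rightarrow> nat \<Rightarrow> nat \<Rightarrow> nat list \<Rightarrow> (nat \<Rightarrow> nat) \<Rightarrow> nat \<Rightarrow> config \<Rightarrow> mem option" where
  "run p w S X R 0 (pc, M) = (if pc < length p \<and> p ! pc = Halt then Some M else None)"
| "run p w S X R (Suc T) (pc, M) =
     (if length p \<le> pc then None
      else if p ! pc = Halt then Some M
      else if \<not> touched (p ! pc) M \<subseteq> {..<S} then None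
      else run p w S X R T (exec w X R (p ! pc) (pc, M)))"

text \<open>
  A query is written to the first cells of the local memory and answered in cell 0. The rest of
  the local memory persists from one query to the next.
\<close>

definition put_query :: "nat list \<Rightarrow> mem \<Rightarrow> mem" where
  "put_query q M = (\<lambda>i. if i < length q then q ! i else M i)"

fun answers :: "instr list \<Rightarrow> nat \<Rightarrow> nat \<Rightarrow> nat list \<Rightarrow> (nat \<Rightarrow> nat) \<Rightarrow> nat \<Rightarrow> mem \<Rightarrow> nat list list
    \<Rightarrow> bool list option" where
  "answers p w S X R T M [] = Some []"
| "answers p w S X R T M (q # qs) =
     (case run p w S X R T (0, put_query q M) of
        None \<Rightarrow> None
      | Some M' \<Rightarrow> map_option ((#) (M' 0 \<noteq> 0)) (answers p w S X R T M' qs))"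

text \<open>The random tape has one independent uniform word for each word-sized address.\<close>

definition random_tape :: "nat \<Rightarrow> (nat \<Rightarrow> nat) pmf" where
  "random_tape w = Pi_pmf {..<2 ^ w} 0 (\<lambda>_. pmf_of_set {..<2 ^ w})"


section \<open>Local computation algorithms\<close>

text \<open>
  A solution is identified with the function mapping each query (a list of words) to the part of
  the solution it asks for, here a single bit.
\<close>

record 'x search_problem =
  instances :: "'x set"
  instance_size :: "'x \<Rightarrow> nat"
  input_words :: "'x \<Rightarrow> nat list"
  queries :: "'x \<Rightarrow> nat list set"
  solutions :: "'x \<Rightarrow> (nat list \<Rightarrow> bool) set"

text \<open>
  Words have \<open>c\<close> times as many bits as \<open>n\<close>, i.e. \<open>\<Theta>(log n)\<close> bits. The space bound \<open>s n\<close> is counted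
  in bits, so the local memory has \<open>s n div w\<close> words. Time and space bounds hold for every
  content of the random tape and after every history of queries; only the correctness of
  the answers is probabilistic. In the success event a single solution, depending only on the tape,
  is consistent with the answers to all sequences of queries. The random tape can be reread and is not
  part of the local memory.
\<close>

definition local_computation_algorithm ::
  "(nat \<Rightarrow> nat) \<Rightarrow> (nat \<Rightarrow> nat) \<Rightarrow> (nat \<Rightarrow> real) \<Rightarrow> 'x search_problem \<Rightarrow> nat \<Rightarrow> instr list \<Rightarrow> bool" where
  "local_computation_algorithm t s \<delta> P c p \<longleftrightarrow>
     0 < c \<and>
     (\<forall>x \<in> instances P.
        let n = instance_size P x;
            w = c * floorlog 2 n;
            X = input_words P x;
            ans = (\<lambda>R qs. answers p w (s n div w) X R (t n) (\<lambda>_. 0) qs)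
        in length X \<le> 2 ^ w \<and> set X \<subseteq> {..<2 ^ w} \<and>
           (\<forall>R \<in> set_pmf (random_tape w). \<forall>qs \<in> lists (queries P x). ans R qs \<noteq> None) \<and>
           measure_pmf.prob (random_tape w)
             {R. \<exists>y \<in> solutions P x. \<forall>qs \<in> lists (queries P x). ans R qs = Some (map y qs)}
             \<ge> 1 - \<delta> n)"


section \<open>The maximal matching problem\<close>

definition adjacency_lists :: "nat \<Rightarrow> nat set set \<Rightarrow> nat list list \<Rightarrow> bool" where
  "adjacency_lists n E A \<longleftrightarrow>
     length A = n \<and> (\<forall>v<n. distinct (A ! v) \<and> set (A ! v) = {u. {u, v} \<in> E})"

text \<open>
  Word 0 of the input is \<open>n\<close>; the neighbours of vertex \<open>v\<close> occupy the positions from the one stored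
  in word \<open>v + 1\<close> up to (excluding) the one stored in word \<open>v + 2\<close>.
\<close>

definition encode_adjacency :: "nat list list \<Rightarrow> nat list" where
  "encode_adjacency A =
     length A # map (\<lambda>v. length A + 2 + length (concat (take v A))) [0..<length A + 1] @ concat A"

text \<open>
  An instance \<open>(n, E, A)\<close> consists of a graph on the vertices \<open>0, ..., n - 1\<close> together with an
  arbitrary ordering of its adjacency lists.
\<close>

definition maximal_matching_problem ::
  "nat \<Rightarrow> (nat \<times> nat set set \<times> nat list list) search_problem" where
  "maximal_matching_problem d =
     \<lparr> instances = {(n, E, A). 0 < n \<and> simple_graph {..<n} E \<and> max_degree {..<n} E = d \<and>
                              adjacency_lists n E A},
       instance_size = (\<lambda>(n, E, A). n),
       input_words = (\<lambda>(n, E, A). encode_adjacency A),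
       queries = (\<lambda>(n, E, A). {[u, v] | u v. {u, v} \<in> E}),
       solutions = (\<lambda>(n, E, A). {\<lambda>q. {q ! 0, q ! 1} \<in> M | M. maximal_matching E M}) \<rparr>"

end

(*
  The algorithm is deterministic and ignores the random tape. Three rounds of the colour reduction of
  Goldberg and Plotkin turn the edge identifiers, seen as a proper colouring of the line graph, into
  a proper colouring with only (log log log n)^O(d) colours: the new colour of an edge lists, for
  each of its at most 2d neighbours, the position of a bit in which the two old colours differ
  together with the own value of that bit. The matching is the greedy one: an edge is chosen iff no
  neighbour of smaller colour is chosen. Whether an edge is chosen depends only on the paths of
  decreasing colour starting from it, so it can be computed on a tree of depth (log log log n)^O(d).
  This tree has O(log n) nodes, and each round spends O(log n) steps per node, for a total of
  O(log^2 n) time and O(log n) words.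
*)
theory Submission
  imports Defs "HOL-Real_Asymp.Real_Asymp"
begin

section \<open>A structured language for the word RAM\<close>

text \<open>Two rounds would leave (log log n)^O(d) colours, and a tree of that depth has more than
  polylogarithmically many nodes. After three, the logarithm of the tree size is polynomial in log
  log log n, hence o(log log n).

  The machine has no call stack, so recursive exploration is replaced by passes over an array that
  holds a complete \<open>D\<close>-ary tree, \<open>D = 2 * d\<close>. It is cut off after a number
  \<open>N = C * floorlog 2 n\<close> of inner positions, not at a depth, and positions near the cut
  hold garbage. The condition \<open>Suc i * (D + 1) ^ k \<le> N\<close> keeps the garbage at least
  \<open>k\<close> levels away from position \<open>i\<close>. A colouring round uses up one such
  level and so does each descent in colour, so the root needs three levels for the rounds, as many
  as its colour, and one more.

  Consistency holds because the colour of an edge and the decision about it are functions of the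
  edge alone, not of its place in some tree. Each query recomputes everything from the input,
  starting from arbitrary memory, so the history has no influence.\<close>

datatype expr = Num nat | Var nat | Bin binop expr expr | Ld expr | Inp expr

datatype com = Asg nat expr | Sto expr expr | Seq com com (infixr ";;" 60) | While expr com

abbreviation (input) tmp :: nat where "tmp \<equiv> 20"
abbreviation (input) base :: nat where "base \<equiv> 30"

text \<open>Scratch cells needed by stack evaluation: the left operand occupies one cell while the
  right one is evaluated.\<close>

fun height :: "expr \<Rightarrow> nat" where
  "height (Num k) = 1"
| "height (Var i) = 1"
| "height (Bin f a b) = max (height a) (Suc (height b))"
| "height (Ld a) = height a"
| "height (Inp a) = height a"

lemma height_pos: "height e > 0"
  by (induction e) auto

text \<open>\<open>Or\<close> of a cell with itself serves as the move instruction; it does not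
  reduce modulo the word size, so it copies any contents faithfully.\<close>

fun ecode :: "expr \<Rightarrow> nat \<Rightarrow> instr list" where
  "ecode (Num k) r = [Const r k]"
| "ecode (Var i) r = [Op Or r i i]"
| "ecode (Bin f a b) r = ecode a r @ ecode b (Suc r) @ [Op f r r (Suc r)]"
| "ecode (Ld a) r = ecode a r @ [Load r r]"
| "ecode (Inp a) r = ecode a r @ [Input r r]"

text \<open>Jump targets are absolute, hence the start address \<open>a\<close>. Loading zero before
  \<open>Jz\<close> gives the unconditional jump back.\<close>

fun code :: "com \<Rightarrow> nat \<Rightarrow> instr list" where
  "code (Asg i e) a = ecode e tmp @ [Op Or i tmp tmp]"
| "code (Sto e f) a = ecode e tmp @ ecode f (Suc tmp) @ [Store tmp (Suc tmp)]"
| "code (Seq c c') a = code c a @ code c' (a + length (code c a))"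
| "code (While e c) a =
     (let h = a + length (ecode e tmp); m = length (code c (Suc h))
      in ecode e tmp @ Jz tmp (h + m + 3) # code c (Suc h) @ [Const tmp 0, Jz tmp a])"

text \<open>Evaluation has to fit into the ten scratch cells; \<open>Sto\<close> computes its second
  value one cell higher, which leaves nine.\<close>

fun well_formed :: "com \<Rightarrow> bool" where
  "well_formed (Asg i e) \<longleftrightarrow> i < tmp \<and> height e \<le> 10"
| "well_formed (Sto e f) \<longleftrightarrow> height e \<le> 10 \<and> height f \<le> 9"
| "well_formed (Seq c c') \<longleftrightarrow> well_formed c \<and> well_formed c'"
| "well_formed (While e c) \<longleftrightarrow> height e \<le> 10 \<and> well_formed c"

definition code_at :: "instr list \<Rightarrow> nat \<Rightarrow> instr list \<Rightarrow> bool" where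
  "code_at p a xs \<longleftrightarrow> a + length xs \<le> length p \<and> (\<forall>i<length xs. p ! (a + i) = xs ! i)"

lemma code_at_append:
  "code_at p a (xs @ ys) \<longleftrightarrow> code_at p a xs \<and> code_at p (a + length xs) ys"
proof
  assume h: "code_at p a (xs @ ys)"
  have "p ! (a + i) = xs ! i" if "i < length xs" for i
    using h that by (auto simp: code_at_def nth_append dest!: spec[of _ i])
  moreover have "p ! (a + length xs + i) = ys ! i" if "i < length ys" for i
    using h that by (auto simp: code_at_def nth_append add.assoc dest!: spec[of _ "length xs + i"])
  ultimately show "code_at p a xs \<and> code_at p (a + length xs) ys"
    using h by (auto simp: code_at_def)
next
  assume h: "code_at p a xs \<and> code_at p (a + length xs) ys"
  have "p ! (a + i) = (xs @ ys) ! i" if "i < length (xs @ ys)" for i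
  proof (cases "i < length xs")
    case False
    then have "p ! (a + length xs + (i - length xs)) = ys ! (i - length xs)"
      using h that unfolding code_at_def by (metis add_diff_inverse_nat length_append nat_add_left_cancel_less)
    with False show ?thesis by (simp add: nth_append)
  qed (use h in \<open>auto simp: code_at_def nth_append\<close>)
  with h show "code_at p a (xs @ ys)" by (auto simp: code_at_def)
qed

lemma code_at_Cons: "code_at p a (x # xs) \<longleftrightarrow> a < length p \<and> p ! a = x \<and> code_at p (Suc a) xs"
  using code_at_append[of p a "[x]" xs] by (auto simp: code_at_def)

text \<open>
  Cells \<open>tmp\<close> to \<open>base - 1\<close> hold intermediate values of expressions. Assertions see them as zero,
  which makes the semantics of commands a function of the remaining cells.
\<close>
definition clear :: "mem \<Rightarrow> mem" where
  "clear M = (\<lambda>i. if tmp \<le> i \<and> i < base then 0 else M i)"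

lemma run_more: "run p w S X R T c = Some M \<Longrightarrow> T \<le> T' \<Longrightarrow> run p w S X R T' c = Some M"
proof (induction T arbitrary: c T')
  case 0
  then show ?case by (cases c; cases T') (auto split: if_splits)
next
  case (Suc T)
  then show ?case by (cases c; cases T') (auto split: if_splits)
qed

section \<open>Hoare triples with running times\<close>

locale ram =
  fixes w S :: nat and X :: "nat list" and R :: "nat \<Rightarrow> nat"
  assumes space: "base \<le> S"
begin

fun eval :: "expr \<Rightarrow> mem \<Rightarrow> nat" where
  "eval (Num k) M = k mod 2 ^ w"
| "eval (Var i) M = M i"
| "eval (Bin f a b) M = apply_op w f (eval a M) (eval b M)"
| "eval (Ld a) M = M (eval a M)"
| "eval (Inp a) M = (if eval a M < length X then X ! eval a M else 0)"

text \<open>Scratch cells are excluded because \<open>clear\<close> shows them as zero: on the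
  remaining cells an indirect access agrees with the real memory.\<close>

definition avail :: "nat \<Rightarrow> bool" where
  "avail i \<longleftrightarrow> i < S \<and> (i < tmp \<or> base \<le> i)"

fun safe :: "expr \<Rightarrow> mem \<Rightarrow> bool" where
  "safe (Num k) M \<longleftrightarrow> True"
| "safe (Var i) M \<longleftrightarrow> i < tmp"
| "safe (Bin f a b) M \<longleftrightarrow> safe a M \<and> safe b M"
| "safe (Ld a) M \<longleftrightarrow> safe a M \<and> avail (eval a M)"
| "safe (Inp a) M \<longleftrightarrow> safe a M"

text \<open>Equating runs for every remaining amount of time makes step counts add up under
  composition and includes the checks that \<open>run\<close> performs.\<close>

definition reach :: "instr list \<Rightarrow> nat \<Rightarrow> config \<Rightarrow> config \<Rightarrow> bool" where
  "reach p t c c' \<longleftrightarrow> (\<forall>T. run p w S X R (t + T) c = run p w S X R T c')"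

lemma reach_trans: "reach p t c c' \<Longrightarrow> reach p t' c' c'' \<Longrightarrow> reach p (t + t') c c''"
  by (simp add: reach_def add.assoc)

lemma reach_step:
  "a < length p \<Longrightarrow> p ! a = i \<Longrightarrow> i \<noteq> Halt \<Longrightarrow> touched i M \<subseteq> {..<S} \<Longrightarrow>
    reach p 1 (a, M) (exec w X R i (a, M))"
  by (simp add: reach_def)

text \<open>Only cells from \<open>r\<close> to \<open>base - 1\<close> change, so the left operand
  survives in \<open>r\<close> and, through \<open>clear\<close>, both operands are evaluated in the
  same memory.\<close>

lemma ecode_reach:
  assumes "code_at p a (ecode e r)" "safe e (clear M)" "tmp \<le> r" "r + height e \<le> base"
  shows "\<exists>M'. reach p (length (ecode e r)) (a, M) (a + length (ecode e r), M') \<and>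
    M' r = eval e (clear M) \<and> (\<forall>i. i < r \<or> base \<le> i \<longrightarrow> M' i = M i)"
  using assms
proof (induction e arbitrary: a r M)
  case (Num k)
  then have "reach p 1 (a, M) (exec w X R (Const r k) (a, M))"
    using space by (intro reach_step) (auto simp: code_at_Cons)
  then show ?case by (intro exI[of _ "M(r := k mod 2 ^ w)"]) (use Num in \<open>auto simp: fun_upd_def\<close>)
next
  case (Var i)
  then have "reach p 1 (a, M) (exec w X R (Op Or r i i) (a, M))"
    using space by (intro reach_step) (auto simp: code_at_Cons)
  then show ?case by (intro exI[of _ "M(r := M i)"]) (use Var in \<open>auto simp: clear_def fun_upd_def\<close>)
next
  case (Bin f e1 e2)
  let ?l1 = "length (ecode e1 r)" and ?l2 = "length (ecode e2 (Suc r))"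
  from Bin.prems have at: "code_at p a (ecode e1 r)" "code_at p (a + ?l1) (ecode e2 (Suc r))"
    "code_at p (a + ?l1 + ?l2) [Op f r r (Suc r)]"
    by (auto simp: code_at_append add.assoc)
  have h: "r + height e1 \<le> base" "Suc r + height e2 \<le> base"
    using Bin.prems(4) by simp_all
  obtain M1 where M1: "reach p ?l1 (a, M) (a + ?l1, M1)" "M1 r = eval e1 (clear M)"
    "\<forall>i. i < r \<or> base \<le> i \<longrightarrow> M1 i = M i"
    using Bin.IH(1)[OF at(1), of M] Bin.prems(2,3) h(1) by auto
  have clear: "clear M1 = clear M"
    using M1(3) Bin.prems by (auto simp: clear_def fun_eq_iff)
  obtain M2 where M2: "reach p ?l2 (a + ?l1, M1) (a + ?l1 + ?l2, M2)" "M2 (Suc r) = eval e2 (clear M1)"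
    "\<forall>i. i < Suc r \<or> base \<le> i \<longrightarrow> M2 i = M1 i"
    using Bin.IH(2)[OF at(2), of M1] Bin.prems(2,3) h(2) clear by auto
  have "reach p 1 (a + ?l1 + ?l2, M2) (exec w X R (Op f r r (Suc r)) (a + ?l1 + ?l2, M2))"
    using at(3) space h(2) height_pos[of e2] by (intro reach_step) (auto simp: code_at_Cons)
  then have "reach p (?l1 + ?l2 + 1) (a, M) (exec w X R (Op f r r (Suc r)) (a + ?l1 + ?l2, M2))"
    using M1(1) M2(1) reach_trans by blast
  then show ?case
    by (intro exI[of _ "M2(r := apply_op w f (M2 r) (M2 (Suc r)))"])
      (use M1 M2 clear h(2) height_pos[of e2] in \<open>auto simp: add.assoc fun_upd_def\<close>)
next
  case (Ld e)
  let ?l = "length (ecode e r)"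
  from Ld.prems have at: "code_at p a (ecode e r)" "code_at p (a + ?l) [Load r r]"
    by (auto simp: code_at_append)
  obtain M1 where M1: "reach p ?l (a, M) (a + ?l, M1)" "M1 r = eval e (clear M)"
    "\<forall>i. i < r \<or> base \<le> i \<longrightarrow> M1 i = M i"
    using Ld.IH[OF at(1)] Ld.prems by auto
  have "reach p 1 (a + ?l, M1) (exec w X R (Load r r) (a + ?l, M1))"
    using at(2) space Ld.prems M1(2) height_pos[of e]
    by (intro reach_step) (auto simp: code_at_Cons avail_def)
  then have "reach p (?l + 1) (a, M) (exec w X R (Load r r) (a + ?l, M1))"
    using M1(1) reach_trans by blast
  moreover have "M1 (M1 r) = clear M (eval e (clear M))"
    using M1 Ld.prems by (auto simp: avail_def clear_def)
  ultimately have "reach p (?l + 1) (a, M) (Suc (a + ?l), M1(r := clear M (eval e (clear M))))"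
    by simp
  then show ?case
    by (intro exI[of _ "M1(r := clear M (eval e (clear M)))"])
      (use M1 Ld.prems height_pos[of e] in \<open>auto simp: fun_upd_def\<close>)
next
  case (Inp e)
  let ?l = "length (ecode e r)"
  from Inp.prems have at: "code_at p a (ecode e r)" "code_at p (a + ?l) [Input r r]"
    by (auto simp: code_at_append)
  obtain M1 where M1: "reach p ?l (a, M) (a + ?l, M1)" "M1 r = eval e (clear M)"
    "\<forall>i. i < r \<or> base \<le> i \<longrightarrow> M1 i = M i"
    using Inp.IH[OF at(1)] Inp.prems by auto
  have "reach p 1 (a + ?l, M1) (exec w X R (Input r r) (a + ?l, M1))"
    using at(2) space Inp.prems height_pos[of e] by (intro reach_step) (auto simp: code_at_Cons)
  then have "reach p (?l + 1) (a, M) (exec w X R (Input r r) (a + ?l, M1))"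
    using M1(1) reach_trans by blast
  then show ?case
    by (intro exI[of _ "M1(r := (if M1 r < length X then X ! M1 r else 0))"])
      (use M1 Inp.prems height_pos[of e] in \<open>auto simp: fun_upd_def\<close>)
qed

text \<open>Quantifying over \<open>p\<close> and \<open>a\<close> lets one triple serve every
  occurrence of a command, although its code differs in the jump targets.\<close>

definition triple :: "(mem \<Rightarrow> bool) \<Rightarrow> com \<Rightarrow> nat \<Rightarrow> (mem \<Rightarrow> bool) \<Rightarrow> bool" where
  "triple P c T Q \<longleftrightarrow> (\<forall>p a M. code_at p a (code c a) \<and> P (clear M) \<longrightarrow>
     (\<exists>t M'. t \<le> T \<and> reach p t (a, M) (a + length (code c a), M') \<and> Q (clear M')))"

lemma triple_conseq:
  "triple P c T Q \<Longrightarrow> (\<And>M. P' M \<Longrightarrow> P M) \<Longrightarrow> (\<And>M. Q M \<Longrightarrow> Q' M) \<Longrightarrow> T \<le> T' \<Longrightarrow> triple P' c T' Q'"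
  unfolding triple_def by (meson order_trans)

lemma triple_Seq:
  assumes "triple P c T Q" "triple Q c' T' Q'"
  shows "triple P (c ;; c') (T + T') Q'"
  unfolding triple_def
proof (intro allI impI, elim conjE)
  fix p a M assume at: "code_at p a (code (c ;; c') a)" and P: "P (clear M)"
  let ?l = "length (code c a)"
  have at: "code_at p a (code c a)" "code_at p (a + ?l) (code c' (a + ?l))"
    using at by (simp_all add: code_at_append)
  obtain t M1 where 1: "t \<le> T" "reach p t (a, M) (a + ?l, M1)" "Q (clear M1)"
    using assms(1) at(1) P unfolding triple_def by blast
  obtain t' M2 where 2: "t' \<le> T'" "reach p t' (a + ?l, M1) (a + ?l + length (code c' (a + ?l)), M2)"
    "Q' (clear M2)"
    using assms(2) at(2) 1(3) unfolding triple_def by blast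
  show "\<exists>t M'. t \<le> T + T' \<and> reach p t (a, M) (a + length (code (c ;; c') a), M') \<and> Q' (clear M')"
    by (intro exI[of _ "t + t'"] exI[of _ M2])
      (use 1 2 reach_trans in \<open>fastforce simp: add.assoc\<close>)
qed

lemma triple_Asg:
  assumes "well_formed (Asg i e)"
  shows "triple (\<lambda>M. safe e M \<and> Q (M(i := eval e M))) (Asg i e) (length (code (Asg i e) 0)) Q"
  unfolding triple_def
proof (intro allI impI, elim conjE)
  fix p a M assume at: "code_at p a (code (Asg i e) a)" and P: "safe e (clear M)"
    "Q ((clear M)(i := eval e (clear M)))"
  let ?l = "length (ecode e tmp)"
  obtain M1 where M1: "reach p ?l (a, M) (a + ?l, M1)" "M1 tmp = eval e (clear M)"
    "\<forall>i. i < tmp \<or> base \<le> i \<longrightarrow> M1 i = M i"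
    using ecode_reach[of p a e tmp M] at P assms by (auto simp: code_at_append)
  have "reach p 1 (a + ?l, M1) (exec w X R (Op Or i tmp tmp) (a + ?l, M1))"
    using at space assms by (intro reach_step) (auto simp: code_at_append code_at_Cons)
  then have "reach p (?l + 1) (a, M) (exec w X R (Op Or i tmp tmp) (a + ?l, M1))"
    using M1(1) reach_trans by blast
  moreover have "clear (M1(i := M1 tmp)) = (clear M)(i := eval e (clear M))"
    using M1 assms by (auto simp: clear_def fun_eq_iff)
  ultimately show "\<exists>t M'. t \<le> length (code (Asg i e) 0) \<and>
      reach p t (a, M) (a + length (code (Asg i e) a), M') \<and> Q (clear M')"
    using P by (intro exI[of _ "?l + 1"] exI[of _ "M1(i := M1 tmp)"]) auto
qed

lemma triple_Sto:
  assumes "well_formed (Sto e f)"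
  shows "triple (\<lambda>M. safe e M \<and> safe f M \<and> avail (eval e M) \<and> Q (M(eval e M := eval f M)))
    (Sto e f) (length (code (Sto e f) 0)) Q"
  unfolding triple_def
proof (intro allI impI, elim conjE)
  fix p a M assume at: "code_at p a (code (Sto e f) a)"
    and P: "safe e (clear M)" "safe f (clear M)" "avail (eval e (clear M))"
    "Q ((clear M)(eval e (clear M) := eval f (clear M)))"
  let ?l = "length (ecode e tmp)" and ?l2 = "length (ecode f (Suc tmp))"
  let ?i = "Store tmp (Suc tmp)"
  obtain M1 where M1: "reach p ?l (a, M) (a + ?l, M1)" "M1 tmp = eval e (clear M)"
    "\<forall>i. i < tmp \<or> base \<le> i \<longrightarrow> M1 i = M i"
    using ecode_reach[of p a e tmp M] at P assms by (auto simp: code_at_append)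
  have clear: "clear M1 = clear M"
    using M1(3) by (auto simp: clear_def fun_eq_iff)
  obtain M2 where M2: "reach p ?l2 (a + ?l, M1) (a + ?l + ?l2, M2)" "M2 (Suc tmp) = eval f (clear M)"
    "\<forall>i. i < Suc tmp \<or> base \<le> i \<longrightarrow> M2 i = M1 i"
    using ecode_reach[of p "a + ?l" f "Suc tmp" M1] at P assms clear by (auto simp: code_at_append)
  have "reach p 1 (a + ?l + ?l2, M2) (exec w X R ?i (a + ?l + ?l2, M2))"
    using at space P M1 M2
    by (intro reach_step) (auto simp: code_at_append code_at_Cons avail_def add.assoc)
  then have "reach p (?l + ?l2 + 1) (a, M) (exec w X R ?i (a + ?l + ?l2, M2))"
    using M1(1) M2(1) reach_trans by blast
  moreover have "clear (M2(M2 tmp := M2 (Suc tmp))) = (clear M)(eval e (clear M) := eval f (clear M))"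
    using M1 M2 P by (auto simp: clear_def fun_eq_iff avail_def)
  ultimately show "\<exists>t M'. t \<le> length (code (Sto e f) 0) \<and>
      reach p t (a, M) (a + length (code (Sto e f) a), M') \<and> Q (clear M')"
    using P
    by (intro exI[of _ "?l + ?l2 + 1"] exI[of _ "M2(M2 tmp := M2 (Suc tmp))"]) (auto simp: add.assoc)
qed

text \<open>The index of the invariant is the exact number of iterations left, so it is the variant
  and the iteration count at once. Besides test and body an iteration executes three instructions:
  two jumps and a constant.\<close>

lemma triple_While:
  assumes wf: "height e \<le> 10"
    and body: "\<And>k. triple (I (Suc k)) c T (I k)"
    and enter: "\<And>k M. I (Suc k) M \<Longrightarrow> safe e M \<and> eval e M \<noteq> 0"
    and leave: "\<And>M. I 0 M \<Longrightarrow> safe e M \<and> eval e M = 0"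
  shows "triple (I k) (While e c) (k * (T + length (ecode e tmp) + 3) + length (ecode e tmp) + 1) (I 0)"
  unfolding triple_def
proof (intro allI impI, elim conjE)
  fix p a M assume at: "code_at p a (code (While e c) a)" and I: "I k (clear M)"
  let ?l = "length (ecode e tmp)"
  let ?h = "a + ?l"
  let ?m = "length (code c (Suc ?h))"
  let ?fin = "a + length (code (While e c) a)"
  have fin: "?fin = ?h + ?m + 3" by (simp add: Let_def)
  have at1: "code_at p a (ecode e tmp)" "code_at p ?h [Jz tmp (?h + ?m + 3)]"
    "code_at p (Suc ?h) (code c (Suc ?h))" "code_at p (Suc ?h + ?m) [Const tmp 0, Jz tmp a]"
    using at by (auto simp: Let_def code_at_append code_at_Cons code_at_def[of _ _ "[]"])
  have test: "\<exists>M'. reach p (?l + 1) (a, M) (if eval e (clear M) = 0 then ?fin else Suc ?h, M') \<and>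
      clear M' = clear M" if safe: "safe e (clear M)" for M
  proof -
    obtain M1 where M1: "reach p ?l (a, M) (a + ?l, M1)" "M1 tmp = eval e (clear M)"
      "\<forall>i. i < tmp \<or> base \<le> i \<longrightarrow> M1 i = M i"
      using ecode_reach[OF at1(1) safe] wf by auto
    have "reach p 1 (?h, M1) (exec w X R (Jz tmp (?h + ?m + 3)) (?h, M1))"
      using at1(2) space by (intro reach_step) (auto simp: code_at_Cons)
    then have "reach p (?l + 1) (a, M) (exec w X R (Jz tmp (?h + ?m + 3)) (?h, M1))"
      using M1(1) reach_trans by blast
    moreover have "clear M1 = clear M"
      using M1(3) by (auto simp: clear_def fun_eq_iff)
    ultimately show ?thesis unfolding fin by (intro exI[of _ M1]) (auto simp: M1(2))
  qed
  show "\<exists>t M'. t \<le> k * (T + ?l + 3) + ?l + 1 \<and> reach p t (a, M) (?fin, M') \<and> I 0 (clear M')"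
    using I
  proof (induction k arbitrary: M)
    case 0
    then show ?case using test[of M] leave[OF 0] by fastforce
  next
    case (Suc k)
    obtain M1 where M1: "reach p (?l + 1) (a, M) (Suc ?h, M1)" "clear M1 = clear M"
      using test[of M] enter[OF Suc.prems] by auto
    obtain t M2 where M2: "t \<le> T" "reach p t (Suc ?h, M1) (Suc ?h + ?m, M2)" "I k (clear M2)"
      using body[of k] at1(3) Suc.prems M1(2) unfolding triple_def by metis
    have 3: "reach p 1 (Suc ?h + ?m, M2) (exec w X R (Const tmp 0) (Suc ?h + ?m, M2))"
      using at1(4) space by (intro reach_step) (auto simp: code_at_Cons)
    have 4: "reach p 1 (Suc (Suc ?h + ?m), M2(tmp := 0))
        (exec w X R (Jz tmp a) (Suc (Suc ?h + ?m), M2(tmp := 0)))"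
      using at1(4) space by (intro reach_step) (auto simp: code_at_Cons)
    have "reach p (?l + 1 + t + 1 + 1) (a, M) (a, M2(tmp := 0))"
      using reach_trans[OF reach_trans[OF reach_trans[OF M1(1) M2(2)]], of 1 _ 1] 3 4 by simp
    moreover have "clear (M2(tmp := 0)) = clear M2"
      by (auto simp: clear_def fun_eq_iff)
    moreover from this have "I k (clear (M2(tmp := 0)))"
      using M2(3) by simp
    from Suc.IH[OF this] obtain t' M3 where 5: "t' \<le> k * (T + ?l + 3) + ?l + 1"
      "reach p t' (a, M2(tmp := 0)) (?fin, M3)" "I 0 (clear M3)"
      by blast
    ultimately have "reach p (?l + 1 + t + 1 + 1 + t') (a, M) (?fin, M3)"
      using reach_trans by blast
    with 5 M2(1) show ?case
      by (intro exI[of _ "?l + 1 + t + 1 + 1 + t'"] exI[of _ M3]) simp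
  qed
qed

text \<open>Covers straight-line code only; loops get the precondition \<open>False\<close> and are
  treated by \<open>triple_While\<close>.\<close>

fun wp :: "com \<Rightarrow> (mem \<Rightarrow> bool) \<Rightarrow> mem \<Rightarrow> bool" where
  "wp (Asg i e) Q M \<longleftrightarrow> safe e M \<and> Q (M(i := eval e M))"
| "wp (Sto e f) Q M \<longleftrightarrow> safe e M \<and> safe f M \<and> avail (eval e M) \<and> Q (M(eval e M := eval f M))"
| "wp (Seq c c') Q M \<longleftrightarrow> wp c (wp c' Q) M"
| "wp (While e c) Q M \<longleftrightarrow> False"

lemma triple_False: "triple (\<lambda>_. False) c T Q"
  by (simp add: triple_def)

text \<open>Without loops every instruction is executed once, so the code length bounds the time; it
  is the same at every start address.\<close>

lemma triple_wp: "well_formed c \<Longrightarrow> triple (wp c Q) c (length (code c 0)) Q"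
proof (induction c arbitrary: Q)
  case (Asg i e)
  show ?case using triple_Asg[OF Asg] by (rule triple_conseq) (auto simp: fun_upd_def)
next
  case (Sto e f)
  show ?case using triple_Sto[OF Sto] by (rule triple_conseq) (auto simp: fun_upd_def)
next
  case (Seq c c')
  have len: "length (code c a) = length (code c b)" for c a b
  proof (induction c arbitrary: a b)
    case (Seq c c')
    then show ?case by (metis (no_types, lifting) code.simps(3) length_append)
  next
    case (While e c)
    then show ?case by (auto simp: Let_def)
  qed auto
  show ?case
    by (rule triple_conseq[OF triple_Seq[OF Seq.IH(1) Seq.IH(2)]])
      (use Seq.prems len[of c' "length (code c 0)" 0] in auto)
next
  case (While e c)
  then show ?case by (simp add: triple_False)
qed

lemma triple_straight:
  assumes "well_formed c" "\<And>M. P M \<Longrightarrow> wp c Q M" "length (code c 0) \<le> T"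
  shows "triple P c T Q"
  using triple_conseq[OF triple_wp[OF assms(1)]] assms(2,3) by blast

end

section \<open>Colour reduction\<close>

text \<open>
  \<open>low b 0 z\<close> is the position of the lowest of the first \<open>b\<close> bits of \<open>z\<close> that is set, and \<open>0\<close> if there
  is none. The second argument is the accumulator of the downward search that the program performs.
\<close>
fun low :: "nat \<Rightarrow> nat \<Rightarrow> nat \<Rightarrow> nat" where
  "low 0 k z = k"
| "low (Suc y) k z = low y (if bit z y then y else k) z"

lemma bit_low: "(\<exists>y<b. bit z y) \<or> bit z k \<Longrightarrow> bit z (low b k z)"
proof (induction b k z rule: low.induct)
  case (2 y k z)
  have "(\<exists>y'<y. bit z y') \<or> bit z (if bit z y then y else k)"
    using "2.prems" by (auto elim: less_SucE)
  from "2.IH"[OF this] show ?case by simp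
qed auto

lemma low_less: "0 < b \<Longrightarrow> low b 0 z < b"
proof -
  have "low b k z < b \<or> low b k z = k" for b k z
    by (induction b k z rule: low.induct) (auto split: if_splits)
  then show "0 < b \<Longrightarrow> low b 0 z < b" by metis
qed

text \<open>The step of Cole and Vishkin: a differing position together with the own bit there,
  coded as one number.\<close>

definition digit :: "nat \<Rightarrow> nat \<Rightarrow> nat \<Rightarrow> nat" where
  "digit b x y = (let k = low b 0 (Bit_Operations.xor x y) in 2 * k + of_bool (bit x k))"

lemma digit_less: "0 < b \<Longrightarrow> digit b x y < 2 * b"
  using low_less[of b "Bit_Operations.xor x y"] by (auto simp: digit_def Let_def)

lemma not_bit_if_less: "(x :: nat) < 2 ^ b \<Longrightarrow> b \<le> i \<Longrightarrow> \<not> bit x i"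
proof -
  assume "x < 2 ^ b" "b \<le> i"
  then have "x < 2 ^ i" by (meson less_le_trans one_le_numeral power_increasing)
  then show ?thesis by (simp add: bit_iff_odd)
qed

text \<open>Equal digits would name the same position and the same bit there, but the position named
  by the first is one where \<open>x\<close> and \<open>y\<close> differ.\<close>

lemma digit_neq:
  assumes "x \<noteq> y" "x < 2 ^ b" "y < 2 ^ b"
  shows "digit b x y \<noteq> digit b y z"
proof
  assume eq: "digit b x y = digit b y z"
  obtain i where i: "bit x i \<noteq> bit y i"
    using assms(1) by (auto simp: bit_eq_iff)
  then have "i < b" using assms not_bit_if_less by (metis linorder_not_le)
  then have k: "bit (Bit_Operations.xor x y) (low b 0 (Bit_Operations.xor x y))"
    using i by (intro bit_low) (auto simp: bit_xor_iff)
  have half: "(2 * k + of_bool P) div 2 = k" "odd (2 * k + of_bool P) \<longleftrightarrow> P" for k :: nat and P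
    by auto
  let ?k = "low b 0 (Bit_Operations.xor x y)" and ?k' = "low b 0 (Bit_Operations.xor y z)"
  have "?k = ?k'" "bit x ?k \<longleftrightarrow> bit y ?k'"
    using eq half unfolding digit_def Let_def by metis+
  with k show False by (simp add: bit_xor_iff)
qed

fun pack :: "nat \<Rightarrow> (nat \<Rightarrow> nat) \<Rightarrow> nat \<Rightarrow> nat" where
  "pack l f 0 = 0"
| "pack l f (Suc j) = pack l f j * 2 ^ l + f j"

lemma pack_less: "\<forall>j<D. f j < 2 ^ l \<Longrightarrow> pack l f D < 2 ^ (D * l)"
proof (induction D)
  case (Suc D)
  then have "pack l f D + 1 \<le> 2 ^ (D * l)" "f D < 2 ^ l" by (auto simp: Suc_le_eq)
  then have "pack l f D * 2 ^ l + f D < (pack l f D + 1) * 2 ^ l" by simp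
  also have "\<dots> \<le> 2 ^ (D * l) * 2 ^ l"
    using \<open>pack l f D + 1 \<le> 2 ^ (D * l)\<close> by (intro mult_right_mono) auto
  finally show ?case by (simp add: power_add mult.commute)
qed simp

lemma pack_eqD:
  assumes "\<forall>j<D. f j < 2 ^ l" "\<forall>j<D. g j < 2 ^ l" "pack l f D = pack l g D" "j < D"
  shows "f j = g j"
  using assms
proof (induction D arbitrary: j)
  case (Suc D)
  have "pack l f D = (pack l f D * 2 ^ l + f D) div 2 ^ l" using Suc.prems(1) by simp
  also have "\<dots> = pack l g D" using Suc.prems(2,3) by simp
  finally have "pack l f D = pack l g D" .
  then have "f D = g D" "j < D \<Longrightarrow> f j = g j"
    using Suc.prems Suc.IH[of j] by auto
  with Suc.prems(4) show ?case by (auto elim: less_SucE)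
qed simp

definition refine :: "nat \<Rightarrow> nat \<Rightarrow> nat \<Rightarrow> (nat \<Rightarrow> nat) \<Rightarrow> nat" where
  "refine D b x ys = pack (floorlog 2 (2 * b)) (\<lambda>j. digit b x (ys j)) D"

lemma digit_less_power: "0 < b \<Longrightarrow> digit b x y < 2 ^ floorlog 2 (2 * b)"
  using digit_less[of b x y] floorlog_leD[of 2 "2 * b"] by (meson less_trans order_refl one_less_numeral_iff semiring_norm(76))

lemma refine_less: "0 < b \<Longrightarrow> refine D b x ys < 2 ^ (D * floorlog 2 (2 * b))"
  unfolding refine_def by (rule pack_less) (simp add: digit_less_power)

text \<open>
  If \<open>y\<close> is the \<open>j\<close>-th neighbour of \<open>x\<close>, the \<open>j\<close>-th digits already tell \<open>x\<close> and \<open>y\<close> apart,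
  no matter which of the neighbours of \<open>y\<close> the digit of \<open>y\<close> refers to.
\<close>
lemma refine_neq:
  assumes "0 < b" "j < D" "x \<noteq> ys j" "x < 2 ^ b" "ys j < 2 ^ b"
  shows "refine D b x ys \<noteq> refine D b (ys j) zs"
proof
  assume "refine D b x ys = refine D b (ys j) zs"
  then have "digit b x (ys j) = digit b (ys j) (zs j)"
    unfolding refine_def
    by (intro pack_eqD[OF _ _ _ assms(2), where l = "floorlog 2 (2 * b)"
          and f = "\<lambda>j. digit b x (ys j)" and g = "\<lambda>j'. digit b (ys j) (zs j')"])
      (simp_all add: digit_less_power assms(1))
  with digit_neq[OF assms(3-5)] show False by blast
qed

text \<open>Colours have \<open>width D L r\<close> bits after \<open>r\<close> rounds.\<close>
fun width :: "nat \<Rightarrow> nat \<Rightarrow> nat \<Rightarrow> nat" where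
  "width D L 0 = 2 * L"
| "width D L (Suc r) = D * floorlog 2 (2 * width D L r)"

lemma width_pos: "0 < D \<Longrightarrow> 0 < L \<Longrightarrow> 0 < width D L r"
  by (induction r) (auto simp: floorlog_def)

lemma floorlog_le_self: "floorlog 2 m \<le> m"
  using less_exp[of m] by (simp add: floorlog_le_iff)

text \<open>Deliberately crude: it only serves to show that words of \<open>O(L)\<close> bits hold
  all colours.\<close>

lemma width_le: "width D L r \<le> (2 * D) ^ r * (2 * L)"
proof (induction r)
  case (Suc r)
  have "width D L (Suc r) \<le> D * (2 * width D L r)"
    by (simp add: floorlog_le_self)
  also have "\<dots> \<le> D * (2 * ((2 * D) ^ r * (2 * L)))"
    by (intro mult_left_mono Suc) simp_all
  finally show ?case by (simp add: algebra_simps)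
qed simp

text \<open>The specification of the rounds on the whole graph, free of any tree.\<close>

fun colour :: "nat \<Rightarrow> nat \<Rightarrow> (nat \<Rightarrow> nat \<Rightarrow> nat) \<Rightarrow> nat \<Rightarrow> nat \<Rightarrow> nat" where
  "colour D L nu 0 x = x"
| "colour D L nu (Suc r) x =
     refine D (width D L r) (colour D L nu r x) (\<lambda>j. colour D L nu r (nu j x))"

section \<open>Evaluation on the exploration tree\<close>

text \<open>
  The \<open>D\<close>-ary exploration tree is laid out like a heap: the children of position \<open>i\<close> are the positions
  \<open>D * i + 1, \<dots>, D * i + D\<close>.
\<close>
fun heap :: "nat \<Rightarrow> (nat \<Rightarrow> nat \<Rightarrow> nat) \<Rightarrow> nat \<Rightarrow> nat \<Rightarrow> nat" where
  "heap D nu x 0 = x"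
| "heap D nu x (Suc i) = nu (i mod D) (heap D nu x (i div D))"

lemma heap_child: "j < D \<Longrightarrow> heap D nu x (D * i + 1 + j) = nu j (heap D nu x i)"
  by simp

text \<open>
  The contents of the array after \<open>r\<close> rounds that process the first \<open>N\<close> positions only. Positions too
  close to the leaves hold meaningless values.
\<close>
fun sweep :: "nat \<Rightarrow> nat \<Rightarrow> (nat \<Rightarrow> nat \<Rightarrow> nat) \<Rightarrow> nat \<Rightarrow> nat \<Rightarrow> nat \<Rightarrow> nat \<Rightarrow> nat" where
  "sweep D L nu N x 0 i = heap D nu x i"
| "sweep D L nu N x (Suc r) i =
     (if i < N then refine D (width D L r) (sweep D L nu N x r i) (\<lambda>j. sweep D L nu N x r (D * i + 1 + j))
      else sweep D L nu N x r i)"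

text \<open>The inequality says that \<open>k\<close> levels below position \<open>i\<close> still
  have indices below \<open>N\<close>. The factor \<open>D + 1\<close> instead of \<open>D\<close>
  absorbs the offsets of the heap layout.\<close>

lemma child_bound:
  assumes "Suc i * (D + 1) ^ Suc k \<le> N" "j < D"
  shows "Suc (D * i + 1 + j) * (D + 1) ^ k \<le> N"
proof -
  have "Suc (D * i + 1 + j) \<le> Suc i * (D + 1)" using assms(2) by simp
  then have "Suc (D * i + 1 + j) * (D + 1) ^ k \<le> Suc i * (D + 1) * (D + 1) ^ k"
    by (rule mult_right_mono) simp
  also have "\<dots> = Suc i * (D + 1) ^ Suc k" by (simp only: power_Suc mult.assoc)
  finally show ?thesis using assms(1) by (rule order_trans)
qed

lemma index_bound: "Suc i * (D + 1) ^ k \<le> N \<Longrightarrow> i < N"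
proof -
  assume "Suc i * (D + 1) ^ k \<le> N"
  moreover have "Suc i * 1 \<le> Suc i * (D + 1) ^ k" by (rule mult_left_mono) simp_all
  ultimately show ?thesis by simp
qed

text \<open>Each round looks one level down, so after \<open>r\<close> rounds the values are right
  wherever \<open>r\<close> levels below lie in the processed part.\<close>

lemma sweep_eq_colour:
  "Suc i * (D + 1) ^ r \<le> N \<Longrightarrow> sweep D L nu N x r i = colour D L nu r (heap D nu x i)"
proof (induction r arbitrary: i)
  case (Suc r)
  have "sweep D L nu N x r i = colour D L nu r (heap D nu x i)"
    using Suc.prems by (intro Suc.IH) (simp add: algebra_simps)
  moreover have "sweep D L nu N x r (D * i + 1 + j) = colour D L nu r (nu j (heap D nu x i))"
    if "j < D" for j
    using Suc.IH[OF child_bound[OF Suc.prems that]] heap_child[OF that, of nu x i] by simp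
  \<comment> \<open>The two sides are known to agree only on the slots below \<open>D\<close>, which
    are the ones that \<open>refine\<close> reads.\<close>
  moreover have "refine D b y f = refine D b y g" if "\<forall>j<D. f j = g j" for b y and f g :: "nat \<Rightarrow> nat"
  proof -
    have "pack l (\<lambda>j. digit b y (f j)) D' = pack l (\<lambda>j. digit b y (g j)) D'" if "D' \<le> D" for l D'
      using that \<open>\<forall>j<D. f j = g j\<close> by (induction D') auto
    then show ?thesis by (simp add: refine_def)
  qed
  ultimately show ?case using index_bound[OF Suc.prems] by simp
qed simp

text \<open>A colour that survives encodes ``in the matching'', \<open>mx\<close> encodes ``not in the matching''.\<close>
function settle :: "nat \<Rightarrow> nat \<Rightarrow> nat \<Rightarrow> (nat \<Rightarrow> nat) \<Rightarrow> nat \<Rightarrow> nat" where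
  "settle D N mx c i =
     (if i < N then if \<exists>j\<in>{..<D}. settle D N mx c (D * i + 1 + j) < c i then mx else c i else c i)"
  by auto
termination
proof (relation "Wellfounded.measure (\<lambda>(D, N, mx, c, i). N - i)")
  fix D N i j :: nat and mx :: nat and c :: "nat \<Rightarrow> nat"
  assume "i < N" "j \<in> {..<D}"
  then have "i < D * i + 1 + j" by (cases D) auto
  with \<open>i < N\<close> show "((D, N, mx, c, D * i + 1 + j), D, N, mx, c, i) \<in> Wellfounded.measure (\<lambda>(D, N, mx, c, i). N - i)"
    by (simp only: in_measure prod.case)
qed simp

declare settle.simps[simp del]

text \<open>The recursion descends strictly in colour, so it makes sense for any \<open>c\<close>,
  proper or not.\<close>

function chosen :: "nat \<Rightarrow> (nat \<Rightarrow> nat) \<Rightarrow> (nat \<Rightarrow> nat \<Rightarrow> nat) \<Rightarrow> nat \<Rightarrow> bool" where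
  "chosen D c nu x \<longleftrightarrow> (\<forall>j\<in>{..<D}. c (nu j x) < c x \<longrightarrow> \<not> chosen D c nu (nu j x))"
  by auto
termination by (relation "Wellfounded.measure (\<lambda>(D, c, nu, x). c x)") auto

declare chosen.simps[simp del]

text \<open>Induction on the colour: a child of smaller colour needs a level less and is settled
  correctly; if it is not chosen it holds \<open>mx\<close>, which undercuts nothing. The
  \<open>r\<close> levels, and one more for the children, keep the colours themselves
  correct.\<close>

lemma settle_eq:
  assumes c: "\<And>i. Suc i * (D + 1) ^ r \<le> N \<Longrightarrow> c i = chi (heap D nu x i)"
    and mx: "\<And>i. c i \<le> mx"
    and i: "Suc i * (D + 1) ^ (r + chi (heap D nu x i) + 1) \<le> N"
  shows "settle D N mx c i = (if chosen D chi nu (heap D nu x i) then chi (heap D nu x i) else mx)"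
  using i
proof (induction "chi (heap D nu x i)" arbitrary: i rule: less_induct)
  case less
  let ?k = "chi (heap D nu x i)"
  have weaken: "Suc i * (D + 1) ^ k \<le> N" if "k \<le> k'" "Suc i * (D + 1) ^ k' \<le> N" for i k k'
  proof -
    have "Suc i * (D + 1) ^ k \<le> Suc i * (D + 1) ^ k'"
      using that(1) by (intro mult_left_mono power_increasing) auto
    with that(2) show ?thesis by simp
  qed
  have ci: "c i = ?k" by (rule c, rule weaken[OF _ less.prems]) simp
  have child: "settle D N mx c (D * i + 1 + j) < c i \<longleftrightarrow>
      chi (nu j (heap D nu x i)) < ?k \<and> chosen D chi nu (nu j (heap D nu x i))" if "j < D" for j
  proof -
    let ?i = "D * i + 1 + j"
    have h: "heap D nu x ?i = nu j (heap D nu x i)" by (rule heap_child[OF that])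
    have b: "Suc ?i * (D + 1) ^ (r + ?k) \<le> N"
      using child_bound[OF _ that, of i "r + ?k"] less.prems by simp
    have c': "c ?i = chi (heap D nu x ?i)" by (rule c, rule weaken[OF _ b]) simp
    show ?thesis
    proof (cases "chi (heap D nu x ?i) < ?k")
      case True
      have "settle D N mx c ?i = (if chosen D chi nu (heap D nu x ?i) then chi (heap D nu x ?i) else mx)"
        by (rule less.hyps[OF True], rule weaken[OF _ b]) (use True in simp)
      then show ?thesis using True h ci mx[of i] by auto
    next
      case False
      \<comment> \<open>True for garbage as well: settling never lowers a value, so a child whose
        colour is not smaller cannot undercut its parent.\<close>
      have "settle D N mx c ?i \<ge> c ?i"
        using mx[of ?i] by (subst settle.simps) auto
      then show ?thesis using False c' h ci by auto
    qed
  qed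
  have "i < N" by (rule index_bound[OF less.prems])
  then show ?case
    using child ci by (subst settle.simps, subst chosen.simps) auto
qed

section \<open>The line graph\<close>

text \<open>Sorting the ends gives both orders of a query the same number; \<open>div n\<close> and
  \<open>mod n\<close> recover the ends.\<close>

definition edge_id :: "nat \<Rightarrow> nat \<Rightarrow> nat \<Rightarrow> nat" where
  "edge_id n a b = min a b * n + max a b"

definition other_end :: "nat list list \<Rightarrow> nat \<Rightarrow> nat \<Rightarrow> nat \<Rightarrow> nat" where
  "other_end A a b j = (if j < length (A ! a) then A ! a ! j else b)"

text \<open>
  Slots \<open>m\<close> beyond the degree of the endpoint yield the edge \<open>x\<close> itself, which is harmless since only
  neighbours of strictly smaller colour matter.
\<close>
definition next_edge :: "nat \<Rightarrow> nat list list \<Rightarrow> nat \<Rightarrow> nat \<Rightarrow> nat" where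
  "next_edge n A m x = (let a = x div n; b = x mod n in
     if even m then edge_id n a (other_end A a b (m div 2)) else edge_id n b (other_end A b a (m div 2)))"

locale instance_graph =
  fixes n d :: nat and E :: "nat set set" and A :: "nat list list"
  assumes graph: "simple_graph {..<n} E" and deg: "max_degree {..<n} E = d"
    and adj: "adjacency_lists n E A"
begin

lemma edge_bounds:
  assumes "{a, b} \<in> E"
  shows "a < n" "b < n" "a \<noteq> b"
  using graph assms by (fastforce simp: simple_graph_def)+

lemma edge_cases:
  assumes "e \<in> E"
  obtains a b where "e = {a, b}" "a < b" "b < n"
proof -
  obtain a b where e: "e = {a, b}" "a \<noteq> b"
    using graph assms by (auto simp: simple_graph_def card_2_iff)
  then have "a < n" "b < n" using edge_bounds assms by auto
  with e that[of a b] that[of b a] show ?thesis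
    by (cases "a < b") (auto simp: insert_commute)
qed

lemma edge_id_commute: "edge_id n a b = edge_id n b a"
  by (simp add: edge_id_def min.commute max.commute)

lemma edge_id_eq: "a < b \<Longrightarrow> edge_id n a b = a * n + b"
  by (simp add: edge_id_def)

lemma edge_id_less: "a < n \<Longrightarrow> b < n \<Longrightarrow> edge_id n a b < n * n"
proof -
  assume "a < n" "b < n"
  then have "min a b + 1 \<le> n" "max a b < n" by auto
  then have "edge_id n a b < (min a b + 1) * n" by (simp add: edge_id_def)
  also have "\<dots> \<le> n * n" using \<open>min a b + 1 \<le> n\<close> by (rule mult_right_mono) simp
  finally show ?thesis .
qed

lemma edge_id_inj:
  assumes "{a, b} \<in> E" "{a', b'} \<in> E" "edge_id n a b = edge_id n a' b'"
  shows "{a, b} = {a', b'}"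
proof -
  have *: "edge_id n a b div n = min a b" "edge_id n a b mod n = max a b" if "{a, b} \<in> E" for a b
    using edge_bounds[OF that] by (simp_all add: edge_id_def)
  have "min a b = min a' b'" "max a b = max a' b'"
    using *[OF assms(1)] *[OF assms(2)] assms(3) by metis+
  then show ?thesis by (auto simp: min_def max_def split: if_splits)
qed

definition edge_ids :: "nat set" where
  "edge_ids = {edge_id n a b | a b. {a, b} \<in> E}"

abbreviation nbr :: "nat \<Rightarrow> nat \<Rightarrow> nat" where
  "nbr \<equiv> next_edge n A"

lemma length_A: "length A = n"
  using adj by (simp add: adjacency_lists_def)

lemma adj_nth: "a < n \<Longrightarrow> j < length (A ! a) \<Longrightarrow> {a, A ! a ! j} \<in> E"
  using adj nth_mem[of j "A ! a"] by (auto simp: adjacency_lists_def insert_commute)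

lemma adj_ex:
  assumes "{a, b} \<in> E"
  obtains j where "j < length (A ! a)" "A ! a ! j = b"
proof -
  have "b \<in> set (A ! a)"
    using adj edge_bounds[OF assms] assms by (auto simp: adjacency_lists_def insert_commute)
  then show ?thesis using that by (auto simp: in_set_conv_nth)
qed

lemma length_adj: "a < n \<Longrightarrow> length (A ! a) \<le> d"
proof -
  assume a: "a < n"
  have E: "finite E"
    by (rule finite_subset[of _ "Pow {..<n}"]) (use graph in \<open>auto simp: simple_graph_def\<close>)
  have "length (A ! a) = card (set (A ! a))"
    using adj a by (metis adjacency_lists_def distinct_card)
  also have "\<dots> = card ((\<lambda>u. {u, a}) ` {u. {u, a} \<in> E})"
    using adj a by (subst card_image) (auto simp: adjacency_lists_def inj_on_def doubleton_eq_iff)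
  also have "\<dots> \<le> card {e \<in> E. a \<in> e}"
    by (rule card_mono) (use E in auto)
  also have "\<dots> \<le> max_degree {..<n} E"
    unfolding max_degree_def degree_def[symmetric] using a by (intro Max_ge) auto
  finally show ?thesis using deg by simp
qed

lemma other_end_edge: "{a, b} \<in> E \<Longrightarrow> {a, other_end A a b j} \<in> E"
  using adj_nth edge_bounds by (auto simp: other_end_def)

lemma nbr_edge_id:
  assumes "a < b" "{a, b} \<in> E"
  shows "nbr m (edge_id n a b) = (if even m then edge_id n a (other_end A a b (m div 2))
    else edge_id n b (other_end A b a (m div 2)))"
  using edge_bounds[OF assms(2)] assms(1) by (simp add: next_edge_def edge_id_eq)

lemma edge_ids_cases:
  assumes "x \<in> edge_ids"
  obtains a b where "a < b" "{a, b} \<in> E" "x = edge_id n a b"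
proof -
  obtain a b where "{a, b} \<in> E" "x = edge_id n a b"
    using assms by (auto simp: edge_ids_def)
  moreover from this(1) have "a \<noteq> b" by (rule edge_bounds)
  ultimately show ?thesis using that[of a b] that[of b a] edge_id_commute
    by (cases "a < b") (auto simp: insert_commute)
qed

lemma nbr_cases:
  assumes "x \<in> edge_ids"
  obtains a b c where "{a, b} \<in> E" "x = edge_id n a b" "{a, c} \<in> E" "nbr m x = edge_id n a c"
proof -
  obtain a b where x: "a < b" "{a, b} \<in> E" "x = edge_id n a b"
    using assms by (rule edge_ids_cases)
  have x': "{b, a} \<in> E" "x = edge_id n b a"
    using x edge_id_commute by (auto simp: insert_commute)
  show ?thesis
  proof (cases "even m")
    case True
    then show ?thesis using x that[OF x(2,3) other_end_edge[OF x(2)]] nbr_edge_id by simp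
  next
    case False
    then show ?thesis using x that[OF x' other_end_edge[OF x'(1)]] nbr_edge_id by simp
  qed
qed

lemma nbr_closed: "x \<in> edge_ids \<Longrightarrow> nbr m x \<in> edge_ids"
  by (erule nbr_cases[of x m]) (auto simp: edge_ids_def)

text \<open>List position \<open>j\<close> of the shared end \<open>a\<close> appears in slot
  \<open>2 * j\<close> if \<open>a\<close> is the smaller end of the edge, and in slot
  \<open>2 * j + 1\<close> otherwise.\<close>

lemma nbr_complete:
  assumes "{a, b} \<in> E" "{a, c} \<in> E"
  shows "\<exists>m<2 * d. nbr m (edge_id n a b) = edge_id n a c"
proof -
  obtain j where j: "j < length (A ! a)" "A ! a ! j = c"
    using assms(2) by (rule adj_ex)
  have jd: "j < d" using j length_adj[of a] edge_bounds[OF assms(1)] by simp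
  show ?thesis
  proof (cases "a < b")
    case True
    then have "nbr (2 * j) (edge_id n a b) = edge_id n a c"
      using j by (simp add: nbr_edge_id[OF True assms(1)] other_end_def)
    then show ?thesis using jd by (intro exI[of _ "2 * j"]) simp
  next
    case False
    then have ba: "b < a" "{b, a} \<in> E" using edge_bounds[OF assms(1)] assms(1) by (auto simp: insert_commute)
    then have "nbr (2 * j + 1) (edge_id n a b) = edge_id n a c"
      using j by (simp add: edge_id_commute[of a b] nbr_edge_id[OF ba] other_end_def)
    then show ?thesis using jd by (intro exI[of _ "2 * j + 1"]) simp
  qed
qed

lemma heap_closed: "x \<in> edge_ids \<Longrightarrow> heap D nbr x i \<in> edge_ids"
  by (induction D nbr x i rule: heap.induct) (auto intro: nbr_closed)

lemma edge_ids_less: "x \<in> edge_ids \<Longrightarrow> x < n * n"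
  by (auto simp: edge_ids_def intro: edge_id_less edge_bounds)

definition greedy :: "(nat \<Rightarrow> nat) \<Rightarrow> nat set set" where
  "greedy c = {{a, b} | a b. {a, b} \<in> E \<and> chosen (2 * d) c nbr (edge_id n a b)}"

lemma greedy_iff: "{a, b} \<in> E \<Longrightarrow> {a, b} \<in> greedy c \<longleftrightarrow> chosen (2 * d) c nbr (edge_id n a b)"
  by (auto simp: greedy_def doubleton_eq_iff edge_id_commute)

text \<open>Of two chosen edges that meet, properness makes one smaller in colour, and it would have
  ruled out the other. An edge that is not chosen has a chosen neighbour, which blocks it.\<close>

lemma maximal_greedy:
  assumes proper: "\<And>x m. x \<in> edge_ids \<Longrightarrow> m < 2 * d \<Longrightarrow> nbr m x \<noteq> x \<Longrightarrow> c (nbr m x) \<noteq> c x"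
  shows "maximal_matching E (greedy c)"
  unfolding maximal_matching_def
proof (intro conjI ballI)
  have sub: "greedy c \<subseteq> E" by (auto simp: greedy_def)
  have False if ab: "{a, b} \<in> greedy c" and ac: "{a, c'} \<in> greedy c" and ne: "{a, b} \<noteq> {a, c'}"
      and le: "c (edge_id n a c') \<le> c (edge_id n a b)" for a b c'
  proof -
    have E: "{a, b} \<in> E" "{a, c'} \<in> E" using ab ac sub by auto
    obtain m where m: "m < 2 * d" "nbr m (edge_id n a b) = edge_id n a c'"
      using nbr_complete[OF E] by blast
    have "edge_id n a c' \<noteq> edge_id n a b" using edge_id_inj[OF E] ne by metis
    then have "c (edge_id n a c') \<noteq> c (edge_id n a b)"
      using proper[of "edge_id n a b" m] m E by (auto simp: edge_ids_def)
    then have "c (nbr m (edge_id n a b)) < c (edge_id n a b)" using m le by simp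
    moreover have "chosen (2 * d) c nbr (edge_id n a b)" "chosen (2 * d) c nbr (edge_id n a c')"
      using ab ac E greedy_iff by auto
    ultimately show False
      using m by (subst (asm) chosen.simps) (auto dest!: bspec[of _ _ m])
  qed
  then have disj: "{a, b} = {a, c'}" if "{a, b} \<in> greedy c" "{a, c'} \<in> greedy c" for a b c'
    using that by (metis nle_le)
  show "matching E (greedy c)"
    unfolding matching_def
  proof (intro conjI sub ballI impI, rule ccontr)
    fix e f assume e: "e \<in> greedy c" and f: "f \<in> greedy c" and ne: "e \<noteq> f" and "e \<inter> f \<noteq> {}"
    then obtain a where a: "a \<in> e" "a \<in> f" by auto
    obtain b where "e = {a, b}"
      using a(1) e sub by (metis edge_cases insertE insert_commute singletonD subsetD)
    moreover obtain c' where "f = {a, c'}"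
      using a(2) f sub by (metis edge_cases insertE insert_commute singletonD subsetD)
    ultimately show False using disj e f ne by blast
  qed
next
  fix e assume e: "e \<in> E - greedy c"
  obtain a b where ab: "e = {a, b}" "{a, b} \<in> E"
    using e by (metis DiffD1 edge_cases)
  then have "\<not> chosen (2 * d) c nbr (edge_id n a b)" using e greedy_iff by auto
  then obtain m where m: "m < 2 * d" "c (nbr m (edge_id n a b)) < c (edge_id n a b)"
    "chosen (2 * d) c nbr (nbr m (edge_id n a b))"
    by (subst (asm) chosen.simps) auto
  have "edge_id n a b \<in> edge_ids" using ab by (auto simp: edge_ids_def)
  then obtain a' b' c' where x: "{a', b'} \<in> E" "edge_id n a b = edge_id n a' b'" "{a', c'} \<in> E"
    "nbr m (edge_id n a b) = edge_id n a' c'"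
    by (rule nbr_cases)
  have e': "e = {a', b'}" using edge_id_inj[OF ab(2) x(1,2)] ab by simp
  have f: "{a', c'} \<in> greedy c" using greedy_iff[OF x(3)] m x by simp
  then have "e \<noteq> {a', c'}" using e by blast
  moreover have "e \<inter> {a', c'} \<noteq> {}" using e' by auto
  moreover have "e \<inter> f = {}" if "matching E (insert e (greedy c))" "f \<in> greedy c" "e \<noteq> f" for f
    using that by (simp add: matching_def)
  ultimately show "\<not> matching E (insert e (greedy c))"
    using f by metis
qed

text \<open>Identifiers are below \<open>n * n\<close>, whence the initial width
  \<open>2 * L\<close>; later rounds are bounded by the packing alone.\<close>

lemma colour_less:
  assumes "0 < d" "0 < L" "n < 2 ^ L" "x \<in> edge_ids"
  shows "colour (2 * d) L nbr r x < 2 ^ width (2 * d) L r"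
proof (cases r)
  case 0
  have "x < n * n" using assms(4) by (rule edge_ids_less)
  also have "\<dots> \<le> 2 ^ L * 2 ^ L" using assms(3) by (intro mult_mono) auto
  finally show ?thesis using 0 by (simp add: mult_2 power_add)
next
  case (Suc r')
  then show ?thesis using refine_less[OF width_pos, of "2 * d" L] assms by simp
qed

lemma colour_proper:
  assumes "0 < d" "0 < L" "n < 2 ^ L" "x \<in> edge_ids" "m < 2 * d" "nbr m x \<noteq> x"
  shows "colour (2 * d) L nbr r (nbr m x) \<noteq> colour (2 * d) L nbr r x"
proof (induction r)
  case 0
  then show ?case using assms by simp
next
  case (Suc r)
  note less = colour_less[OF assms(1-3)]
  let ?b = "width (2 * d) L r" and ?ys = "\<lambda>x j. colour (2 * d) L nbr r (nbr j x)"
  have "refine (2 * d) ?b (colour (2 * d) L nbr r x) (?ys x) \<noteq> refine (2 * d) ?b (?ys x m) (?ys (nbr m x))"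
    by (rule refine_neq[where ys = "?ys x" and j = m])
      (simp_all add: width_pos assms less nbr_closed Suc Suc[symmetric])
  then show ?case by simp
qed

end

section \<open>The size of the exploration tree\<close>

lemma floorlog_le_log: "0 < m \<Longrightarrow> real (floorlog 2 m) \<le> log 2 (real m) + 1"
  using of_int_floor_le[of "log 2 (real m)"] by (simp add: floorlog_def)

lemma two_power_floorlog_le: "0 < m \<Longrightarrow> 2 ^ floorlog 2 m \<le> 2 * m"
  using floorlog_bounds[of m 2] by (simp add: floorlog_def)

text \<open>Three rounds leave \<open>(log log log n)^O(d)\<close> colours, whence the tree has \<open>o(log n)\<close> nodes.\<close>
lemma tree_size_bound:
  assumes D: "0 < D"
  shows "\<exists>C>0. \<forall>L>0. (D + 1) ^ (2 ^ width D L 3 + 4) \<le> C * L"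
proof -
  \<comment> \<open>The exponent covers the levels \<open>r + chi + 1\<close> demanded by
    \<open>settle_eq\<close> for \<open>r = 3\<close> and a colour below
    \<open>2 ^ width D L 3\<close>.\<close>
  define f where "f L = (D + 1) ^ (2 ^ width D L 3 + 4)" for L
  \<comment> \<open>A bound on the number of colours with \<open>y = log 2 L\<close>: it is at most
    \<open>(4 * width D L 2) ^ D\<close>, and the logarithm bounds \<open>width D L 2\<close> up to
    the factor \<open>D\<close>.\<close>
  define g where "g y = (4 * D * log 2 (4 * D * y + 12 * D)) ^ D" for y :: real
  have g: "real (2 ^ width D L 3) \<le> g (log 2 L)" if L: "0 < L" for L
  proof -
    let ?y = "log 2 (real L)"
    have y: "0 \<le> ?y" using L by simp
    have pos: "0 < width D L r" for r using width_pos[OF D L] .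
    have "real (floorlog 2 (4 * L)) \<le> ?y + 3"
      using floorlog_le_log[of "4 * L"] L log_mult[of 2 4 "real L"] log_of_power_eq[of 4 2 2] by simp
    then have "D * real (floorlog 2 (4 * L)) \<le> D * (?y + 3)" by (intro mult_left_mono) simp_all
    then have w1: "real (width D L 1) \<le> D * (?y + 3)" by simp
    have "real (floorlog 2 (2 * width D L 1)) \<le> log 2 (2 * width D L 1) + 1"
      using floorlog_le_log[of "2 * width D L 1"] pos[of 1] by simp
    also have "\<dots> \<le> log 2 (2 * (D * (?y + 3))) + 1"
      using w1 pos[of 1] by simp
    also have "\<dots> = log 2 (4 * D * ?y + 12 * D)"
    proof -
      have p: "0 < D * (?y + 3)" using y D by simp
      have "4 * D * ?y + 12 * D = 2 * (2 * (D * (?y + 3)))" by (simp add: algebra_simps)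
      then show ?thesis using p y D by (simp only: log_mult) auto
    qed
    finally have "D * real (floorlog 2 (2 * width D L 1)) \<le> D * log 2 (4 * D * ?y + 12 * D)"
      by (intro mult_left_mono) simp_all
    then have w2: "real (width D L 2) \<le> D * log 2 (4 * D * ?y + 12 * D)"
      by (simp add: numeral_2_eq_2)
    have "width D L 3 = D * floorlog 2 (2 * width D L 2)"
      by (simp add: numeral_3_eq_3 numeral_2_eq_2)
    then have "(2 :: nat) ^ width D L 3 = (2 ^ floorlog 2 (2 * width D L 2)) ^ D"
      by (simp only: power_mult[symmetric] mult.commute)
    also have "\<dots> \<le> (2 * (2 * width D L 2)) ^ D"
      using two_power_floorlog_le[of "2 * width D L 2"] pos[of 2] by (intro power_mono) simp_all
    finally have "real (2 ^ width D L 3) \<le> real ((2 * (2 * width D L 2)) ^ D)"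
      by (rule of_nat_mono)
    also have "\<dots> = (4 * real (width D L 2)) ^ D" by simp
    also have "\<dots> \<le> (4 * (D * log 2 (4 * D * ?y + 12 * D))) ^ D"
      using w2 by (intro power_mono mult_left_mono) simp_all
    finally show ?thesis by (simp add: g_def mult.assoc)
  qed
  \<comment> \<open>The numerator bounds the logarithm of the tree size without the factor
    \<open>(D + 1) ^ 4\<close>. Being polylogarithmic in \<open>y\<close>, it is eventually below
    \<open>y = log 2 L\<close>.\<close>
  have "((\<lambda>y. log 2 (D + 1) * g y / y) \<longlongrightarrow> 0) at_top"
    unfolding g_def using D by real_asymp
  then have "\<forall>\<^sub>F y in at_top. log 2 (D + 1) * g y / y < 1"
    by (rule order_tendstoD) simp
  moreover have "filterlim (\<lambda>L::nat. log 2 (real L)) at_top at_top"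
    by real_asymp
  ultimately have "\<forall>\<^sub>F L in at_top. log 2 (D + 1) * g (log 2 (real L)) / log 2 (real L) < 1"
    by (rule eventually_compose_filterlim)
  then have "\<forall>\<^sub>F L in at_top. f L \<le> (D + 1) ^ 4 * L"
    using eventually_gt_at_top[of 1]
  proof eventually_elim
    case (elim L)
    let ?k = "2 ^ width D L 3 :: nat"
    have "log 2 (D + 1) * real ?k \<le> log 2 (D + 1) * g (log 2 (real L))"
      using g[of L] elim by (intro mult_left_mono) auto
    also have "\<dots> \<le> log 2 (real L)"
      using elim by (simp add: field_simps)
    finally have "2 powr (log 2 (D + 1) * real ?k) \<le> 2 powr (log 2 (real L))"
      by simp
    also have "2 powr (log 2 (D + 1) * real ?k) = real ((D + 1) ^ ?k)"
      using powr_realpow[of "real (D + 1)" ?k]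
      by (simp add: powr_powr[symmetric] add_pos_nonneg)
    also have "2 powr (log 2 (real L)) = real L" using elim by simp
    finally have "(D + 1) ^ ?k \<le> L" by (simp only: of_nat_le_iff)
    then have "(D + 1) ^ ?k * (D + 1) ^ 4 \<le> L * (D + 1) ^ 4" by (rule mult_right_mono) simp
    then show ?case by (simp only: f_def power_add mult.commute)
  qed
  then obtain L0 where L0: "f L \<le> (D + 1) ^ 4 * L" if "L \<ge> L0" for L
    by (auto simp: eventually_at_top_linorder)
  \<comment> \<open>The finitely many \<open>L\<close> below the threshold are absorbed by adding
    all their values to the constant.\<close>
  have "f L \<le> ((D + 1) ^ 4 + (\<Sum>i<L0. f i)) * L" if "L > 0" for L
  proof (cases "L \<ge> L0")
    case True
    then show ?thesis using L0[OF True] by (simp add: add_mult_distrib)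
  next
    case False
    then have "f L \<le> (\<Sum>i<L0. f i) * 1" by (auto intro: member_le_sum)
    also have "\<dots> \<le> ((D + 1) ^ 4 + (\<Sum>i<L0. f i)) * L" using that by (intro mult_mono) auto
    finally show ?thesis .
  qed
  then show ?thesis unfolding f_def by (intro exI[of _ "(D + 1) ^ 4 + (\<Sum>i<L0. f i)"]) (auto simp: f_def)
qed

section \<open>The program\<close>

text \<open>
  Besides the query \<open>(vU, vV)\<close> and \<open>vn = n\<close>, the main cells are: \<open>ve\<close> end of the inner tree positions,
  \<open>vb\<close> bits per colour, \<open>vl\<close> bits per digit, \<open>vi\<close> address of the current tree position, \<open>vq\<close> address of its
  current child, \<open>vj\<close> index of that child. Tree position \<open>t\<close> is stored in cell \<open>base + t\<close>.
\<close>
abbreviation (input) vU :: nat where "vU \<equiv> 0"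
abbreviation (input) vV :: nat where "vV \<equiv> 1"
abbreviation (input) vn :: nat where "vn \<equiv> 2"
abbreviation (input) ve :: nat where "ve \<equiv> 3"
abbreviation (input) vb :: nat where "vb \<equiv> 4"
abbreviation (input) vl :: nat where "vl \<equiv> 5"
abbreviation (input) vi :: nat where "vi \<equiv> 6"
abbreviation (input) vq :: nat where "vq \<equiv> 7"
abbreviation (input) vj :: nat where "vj \<equiv> 8"
abbreviation (input) vx :: nat where "vx \<equiv> 9"
abbreviation (input) vk :: nat where "vk \<equiv> 10"
abbreviation (input) vs :: nat where "vs \<equiv> 11"
abbreviation (input) vy :: nat where "vy \<equiv> 12"
abbreviation (input) vz :: nat where "vz \<equiv> 13"
abbreviation (input) va :: nat where "va \<equiv> 14"
abbreviation (input) vo :: nat where "vo \<equiv> 15"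

text \<open>A branch-free conditional for \<open>k\<close> in {0, 1}, which keeps the code within
  the reach of \<open>wp\<close>.\<close>

definition sel :: "expr \<Rightarrow> expr \<Rightarrow> expr \<Rightarrow> expr" where
  "sel k a b = Bin Add (Bin Mul k a) (Bin Mul (Bin Eq k (Num 0)) b)"

definition incr :: "nat \<Rightarrow> com" where
  "incr i = Asg i (Bin Add (Var i) (Num 1))"

definition bitlen_loop :: com where
  "bitlen_loop = While (Var vz) (Asg vz (Bin Shr (Var vz) (Num 1)) ;; incr vl)"

definition bitlen :: "expr \<Rightarrow> com" where
  "bitlen e = (Asg vz e ;; Asg vl (Num 0)) ;; bitlen_loop"

text \<open>The larger end is the sum of both minus the smaller one, so a single selection
  suffices.\<close>

definition emit :: "nat \<Rightarrow> com" where
  "emit a =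
     Asg vk (Bin Lt (Var a) (Var vy)) ;;
     Asg vz (sel (Var vk) (Var a) (Var vy)) ;;
     Sto (Var vq) (Bin Add (Bin Mul (Var vz) (Var vn)) (Bin Sub (Bin Add (Var a) (Var vy)) (Var vz))) ;;
     incr vq"

definition side :: "nat \<Rightarrow> nat \<Rightarrow> com" where
  "side a b =
     Asg vz (Bin Add (Inp (Bin Add (Var a) (Num 1))) (Var vj)) ;;
     Asg vk (Bin Lt (Var vz) (Inp (Bin Add (Var a) (Num 2)))) ;;
     Asg vy (sel (Var vk) (Inp (Var vz)) (Var b)) ;;
     emit a"

text \<open>The children of successive positions are contiguous, so \<open>vq\<close> just keeps
  advancing. The two calls of \<open>side\<close> produce an even and an odd slot of
  \<open>next_edge\<close>.\<close>

definition fill_step :: "nat \<Rightarrow> com" where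
  "fill_step d =
     (Asg vx (Ld (Var vi)) ;; Asg va (Bin Div (Var vx) (Var vn)) ;; Asg vo (Bin Mod (Var vx) (Var vn)) ;;
      Asg vj (Num 0)) ;;
     While (Bin Lt (Var vj) (Num d)) (side va vo ;; side vo va ;; incr vj) ;;
     incr vi"

definition fill :: "nat \<Rightarrow> com" where
  "fill d = Asg vi (Num base) ;; While (Bin Lt (Var vi) (Var ve)) (fill_step d)"

definition low_loop :: com where
  "low_loop = While (Var vy)
     (Asg vy (Bin Sub (Var vy) (Num 1)) ;;
      Asg va (Bin And (Bin Shr (Var vz) (Var vy)) (Num 1)) ;;
      Asg vk (sel (Var va) (Var vy) (Var vk)))"

definition digit_step :: com where
  "digit_step =
     (Asg vz (Bin Xor (Var vx) (Ld (Var vq))) ;; Asg vk (Num 0) ;; Asg vy (Var vb)) ;;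
     low_loop ;;
     Asg vs (Bin Add (Bin Shl (Var vs) (Var vl))
       (Bin Add (Bin Mul (Num 2) (Var vk)) (Bin And (Bin Shr (Var vx) (Var vk)) (Num 1)))) ;;
     incr vq ;; incr vj"

text \<open>
  Colours can be overwritten in place, because children come later in the array than their parent and
  are therefore still unchanged when the parent is processed. \<open>settle_step\<close> goes downwards for the
  opposite reason.
\<close>
definition round_step :: "nat \<Rightarrow> com" where
  "round_step D =
     (Asg vx (Ld (Var vi)) ;; Asg vs (Num 0) ;; Asg vj (Num 0)) ;;
     While (Bin Lt (Var vj) (Num D)) digit_step ;;
     Sto (Var vi) (Var vs) ;; incr vi"

definition round :: "nat \<Rightarrow> com" where
  "round D =
     bitlen (Bin Mul (Num 2) (Var vb)) ;;
     (Asg vi (Num base) ;; Asg vq (Num (base + 1))) ;;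
     While (Bin Lt (Var vi) (Var ve)) (round_step D) ;;
     Asg vb (Bin Mul (Num D) (Var vl))"

text \<open>Wraps around to \<open>2 ^ w - 1\<close>, since the program cannot mention
  \<open>w\<close>; it plays the part of \<open>mx\<close>.\<close>

abbreviation maxw :: expr where "maxw \<equiv> Bin Sub (Num 0) (Num 1)"

definition settle_step :: "nat \<Rightarrow> com" where
  "settle_step D =
     (Asg vi (Bin Sub (Var vi) (Num 1)) ;; Asg vx (Ld (Var vi)) ;; Asg vs (Num 0) ;; Asg vj (Num 0)) ;;
     While (Bin Lt (Var vj) (Num D))
       (Asg vq (Bin Sub (Var vq) (Num 1)) ;; Asg vs (Bin Or (Var vs) (Bin Lt (Ld (Var vq)) (Var vx))) ;;
        incr vj) ;;
     Sto (Var vi) (sel (Var vs) maxw (Var vx))"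

text \<open>The settling loop starts from the values of \<open>vi\<close> and \<open>vq\<close> left
  by the last round and runs back to the root, whose surviving colour means acceptance.\<close>

definition main :: "nat \<Rightarrow> nat \<Rightarrow> com" where
  "main d C =
     (Asg vn (Inp (Num 0)) ;; bitlen (Var vn) ;;
      (Asg ve (Bin Add (Num base) (Bin Mul (Num C) (Var vl))) ;; Asg vb (Bin Mul (Num 2) (Var vl)) ;;
       Asg vq (Num base) ;; Asg vy (Var vV) ;; emit vU)) ;;
     fill d ;;
     round (2 * d) ;; round (2 * d) ;; round (2 * d) ;;
     While (Bin Lt (Num base) (Var vi)) (settle_step (2 * d)) ;;
     Asg vU (Bin Lt (Ld (Num base)) maxw)"

lemma floorlog_eq_0_iff: "floorlog 2 m = 0 \<longleftrightarrow> m = 0"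
  by (simp add: floorlog_def)

text \<open>Charges a constant overhead to the iterations of a loop, of which the bound counts at
  least one.\<close>

lemma add_Suc_mult_le: "c + t \<le> t' \<Longrightarrow> c + Suc k * t \<le> Suc k * t'"
  for c t t' k :: nat
proof -
  assume "c + t \<le> t'"
  then have "Suc k * (c + t) \<le> Suc k * t'" by (rule mult_left_mono) simp
  then show ?thesis by (simp add: add_mult_distrib2)
qed

section \<open>Arithmetic without overflow, and loops\<close>

context ram
begin

abbreviation W :: nat where "W \<equiv> 2 ^ w"

lemma eval_Num: "k < W \<Longrightarrow> eval (Num k) M = k"
  by simp

lemma eval_Add: "eval a M + eval b M < W \<Longrightarrow> eval (Bin Add a b) M = eval a M + eval b M"
  by simp

lemma eval_Mul: "eval a M * eval b M < W \<Longrightarrow> eval (Bin Mul a b) M = eval a M * eval b M"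
  by simp

lemma eval_Sub:
  assumes "eval b M \<le> eval a M" "eval a M < W"
  shows "eval (Bin Sub a b) M = eval a M - eval b M"
proof -
  have "eval a M + W - eval b M = (eval a M - eval b M) + W" using assms by simp
  then show ?thesis using assms by (simp del: add_diff_assoc2 diff_add_assoc2 add: less_imp_diff_less)
qed

lemma eval_Shl:
  "eval a M * 2 ^ eval b M < W \<Longrightarrow> eval (Bin Shl a b) M = eval a M * 2 ^ eval b M"
  by (simp add: push_bit_eq_mult)

lemma eval_maxw: "0 < w \<Longrightarrow> eval maxw M = W - 1"
  by simp

lemma eval_bit: "eval (Bin And (Bin Shr a b) (Num (Suc 0))) M = (if w = 0 then 0 else of_bool (bit (eval a M) (eval b M)))"
  by (auto simp: and_one_eq bit_iff_odd_drop_bit mod_2_eq_odd)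

text \<open>Only the selected operand has to fit into a word, because the other is multiplied by
  zero. This tolerates input reads beyond an adjacency list.\<close>

lemma eval_sel:
  assumes "0 < w" "eval k M \<le> 1" "eval k M = 1 \<Longrightarrow> eval a M < W" "eval k M = 0 \<Longrightarrow> eval b M < W"
  shows "eval (sel k a b) M = (if eval k M = 0 then eval b M else eval a M)"
proof (cases "eval k M = 0")
  case False
  then have "eval k M = 1" using assms(2) by simp
  then show ?thesis using assms(3) by (simp add: sel_def)
qed (use assms in \<open>simp add: sel_def\<close>)

declare eval.simps(1)[simp del] eval.simps(3)[simp del]

lemma eval_simps:
  "eval (Bin Div a b) M = eval a M div eval b M"
  "eval (Bin Mod a b) M = eval a M mod eval b M"
  "eval (Bin Lt a b) M = of_bool (eval a M < eval b M)"
  "eval (Bin Or a b) M = Bit_Operations.or (eval a M) (eval b M)"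
  "eval (Bin Xor a b) M = Bit_Operations.xor (eval a M) (eval b M)"
  "eval (Bin Shr a b) M = drop_bit (eval b M) (eval a M)"
  by (simp_all add: eval.simps(3))

lemma safe_sel: "safe (sel k a b) M \<longleftrightarrow> safe k M \<and> safe a M \<and> safe b M"
  by (auto simp: sel_def)

text \<open>At most 17 instructions for the test and three for control make 20; the final failing
  test is charged as a further iteration, hence \<open>Suc K\<close>.\<close>

lemma triple_loop:
  assumes "height e \<le> 10" "length (ecode e tmp) \<le> 17"
    and "\<And>k. triple (I (Suc k)) c T (I k)"
    and "\<And>k M. I (Suc k) M \<Longrightarrow> safe e M \<and> eval e M \<noteq> 0"
    and "\<And>M. I 0 M \<Longrightarrow> safe e M \<and> eval e M = 0"
    and "\<And>M. P M \<Longrightarrow> I k M" "\<And>M. I 0 M \<Longrightarrow> Q M" "k \<le> K" "T + 20 \<le> T'"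
  shows "triple P (While e c) (Suc K * T') Q"
proof (rule triple_conseq[OF triple_While[where I = I and k = k and T = T, OF assms(1,3,4,5)]])
  have "k * (T + length (ecode e tmp) + 3) \<le> k * (T + 20)"
    using assms(2) by (intro mult_left_mono) simp_all
  moreover have "Suc k * (T + 20) \<le> Suc K * T'"
    using assms(8,9) by (intro mult_mono) simp_all
  ultimately show "k * (T + length (ecode e tmp) + 3) + length (ecode e tmp) + 1 \<le> Suc K * T'"
    using assms(2) unfolding mult_Suc by linarith
qed (use assms(6,7) in auto)

text \<open>\<open>P\<close> is the frame, stable under changes of the two cells used. The
  iterations left are the bit length of what remains in \<open>vz\<close>.\<close>

lemma triple_bitlen:
  assumes wf: "well_formed (Asg vz e)" and len: "length (ecode e tmp) \<le> 10"
    and P: "\<And>M x. P M \<Longrightarrow> P (M(vz := x)) \<and> P (M(vl := x))"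
    and e: "\<And>M. P M \<Longrightarrow> safe e M \<and> eval e M = m"
    and m: "floorlog 2 m \<le> w" and w: "1 < w"
  shows "triple P (bitlen e) (100 * Suc w) (\<lambda>M. P M \<and> M vl = floorlog 2 m)"
proof -
  have "w < W" by simp
  then have one: "1 < W" "floorlog 2 m < W" using m w by linarith+
  let ?I = "\<lambda>k M. P M \<and> floorlog 2 (M vz) = k \<and> M vl + k = floorlog 2 m"
  have body: "triple (?I (Suc k)) (Asg vz (Bin Shr (Var vz) (Num 1)) ;; incr vl) 20 (?I k)" for k
  proof (rule triple_straight)
    fix M assume I: "?I (Suc k) M"
    have "M vz \<noteq> 0"
      using I floorlog_eq_0_iff[of "M vz"] by auto
    then have "floorlog 2 (M vz) = Suc (floorlog 2 (M vz div 2))"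
      by (subst compute_floorlog) auto
    then show "wp (Asg vz (Bin Shr (Var vz) (Num 1)) ;; incr vl) (?I k) M"
      using I one P[of M] P[of "M(vz := M vz div 2)"]
      by (simp add: incr_def eval_simps eval_Add eval_Num drop_bit_Suc)
  qed (simp_all add: incr_def)
  have loop: "triple (?I (floorlog 2 m)) bitlen_loop (Suc w * 40) (\<lambda>M. P M \<and> M vl = floorlog 2 m)"
    unfolding bitlen_loop_def
  proof (rule triple_loop[where I = ?I and T = 20 and k = "floorlog 2 m", OF _ _ body])
    fix k M assume "?I (Suc k) M"
    then show "safe (Var vz) M \<and> eval (Var vz) M \<noteq> 0"
      using floorlog_eq_0_iff[of "M vz"] by auto
  next
    fix M assume "?I 0 M"
    then show "safe (Var vz) M \<and> eval (Var vz) M = 0"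
      using floorlog_eq_0_iff[of "M vz"] by auto
  qed (use m in auto)
  have init: "triple P (Asg vz e ;; Asg vl (Num 0)) 30 (?I (floorlog 2 m))"
    by (rule triple_straight) (use wf len e P one in \<open>auto simp: eval_Num\<close>)
  show ?thesis
    unfolding bitlen_def by (rule triple_conseq[OF triple_Seq[OF init loop]]) auto
qed

end

section \<open>Input layout and the setting of one query\<close>

lemma encode_adjacency_nth:
  shows "encode_adjacency A ! 0 = length A"
    and "a \<le> length A \<Longrightarrow> encode_adjacency A ! Suc a = length A + 2 + length (concat (take a A))"
    and "a < length A \<Longrightarrow> j < length (A ! a) \<Longrightarrow>
      encode_adjacency A ! (length A + 2 + length (concat (take a A)) + j) = A ! a ! j"
    and "length (encode_adjacency A) = length A + 2 + length (concat A)"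
proof -
  show "encode_adjacency A ! 0 = length A" by (simp add: encode_adjacency_def)
  show "encode_adjacency A ! Suc a = length A + 2 + length (concat (take a A))" if "a \<le> length A"
    using that by (simp add: encode_adjacency_def nth_append del: upt_Suc)
  show "length (encode_adjacency A) = length A + 2 + length (concat A)"
    by (simp add: encode_adjacency_def)
  show "encode_adjacency A ! (length A + 2 + length (concat (take a A)) + j) = A ! a ! j"
    if a: "a < length A" and j: "j < length (A ! a)"
  proof -
    have "concat A = concat (take a A) @ A ! a @ concat (drop (Suc a) A)"
      using a by (metis concat.simps(2) concat_append id_take_nth_drop)
    then have "concat A ! (length (concat (take a A)) + j) = A ! a ! j"
      using j by (simp add: nth_append)
    then show ?thesis by (simp add: encode_adjacency_def nth_append)
  qed
qed

text \<open>The array has a root and \<open>2 * d\<close> children for each inner position. The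
  first \<open>width\<close> condition makes colours fit into a word with a bit to spare, the second
  does so for the argument of \<open>bitlen\<close>. The summand \<open>d\<close> next to the input
  length leaves room for slots beyond a list.\<close>

locale machine = ram w S "encode_adjacency A" R + instance_graph n d E A
  for w S :: nat and R :: "nat \<Rightarrow> nat" and n d :: nat and E :: "nat set set" and A :: "nat list list" +
  fixes C :: nat and u v :: nat
  assumes uv: "{u, v} \<in> E"
    and mem: "base + 2 * d * (C * floorlog 2 n) + 1 \<le> S"
    and word: "base + 2 * d * (C * floorlog 2 n) + 1 < 2 ^ w" "base + 1 < w" "C < 2 ^ w"
      "n * n < 2 ^ w" "2 * n < 2 ^ w" "length (encode_adjacency A) + d < 2 ^ w" "2 * d < 2 ^ w"
    and width: "\<And>r. r \<le> 3 \<Longrightarrow> width (2 * d) (floorlog 2 n) r < w"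
      "\<And>r. r \<le> 3 \<Longrightarrow> 2 * width (2 * d) (floorlog 2 n) r < 2 ^ w"
    and size: "(2 * d + 1) ^ (2 ^ width (2 * d) (floorlog 2 n) 3 + 4) \<le> C * floorlog 2 n"
begin

abbreviation X :: "nat list" where "X \<equiv> encode_adjacency A"
abbreviation L :: nat where "L \<equiv> floorlog 2 n"
abbreviation N :: nat where "N \<equiv> C * L"
abbreviation D :: nat where "D \<equiv> 2 * d"

definition tree :: "nat \<Rightarrow> nat" where
  "tree = heap D nbr (edge_id n u v)"

lemma root: "edge_id n u v \<in> edge_ids"
  using uv by (auto simp: edge_ids_def)

lemma tree_edge_ids: "tree i \<in> edge_ids"
  unfolding tree_def by (rule heap_closed[OF root])

lemma n_pos: "1 < n"
  using edge_bounds[OF uv] by simp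

lemma d_pos: "0 < d"
  using adj_ex[OF uv] length_adj[of u] edge_bounds[OF uv] by fastforce

lemma W_gt: "k \<le> base + 1 \<Longrightarrow> k < W"
proof -
  assume "k \<le> base + 1"
  then have "k < w" using word(2) by simp
  also have "w < W" by simp
  finally show ?thesis .
qed

lemma small [simp]: "Suc 0 < W" "2 < W" "30 < W" "31 < W"
  using W_gt[of "Suc 0"] W_gt[of 2] W_gt[of 30] W_gt[of 31] by simp_all

definition off :: "nat \<Rightarrow> nat" where
  "off a = length A + 2 + length (concat (take a A))"

lemma off_Suc: "a < n \<Longrightarrow> off (Suc a) = off a + length (A ! a)"
  by (simp add: off_def take_Suc_conv_app_nth length_A)

lemma off_le: "off a \<le> length X"
proof -
  have "length (concat A) = length (concat (take a A)) + length (concat (drop a A))"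
    by (metis append_take_drop_id concat_append length_append)
  then show ?thesis by (simp add: off_def encode_adjacency_nth)
qed

lemma eval_offset:
  assumes "eval e M = a" "a \<le> n"
  shows "eval (Inp (Bin Add e (Num 1))) M = off a"
proof -
  have "a + 1 < W" using assms word(5) n_pos by simp
  then have "eval (Bin Add e (Num 1)) M = a + 1" using assms by (simp add: eval_Add eval_Num)
  moreover have "a + 1 < length X" using assms by (simp add: encode_adjacency_nth length_A)
  ultimately show ?thesis
    using encode_adjacency_nth(2)[of a A] assms by (simp add: off_def length_A)
qed

lemma eval_offset_next:
  assumes "eval e M = a" "a < n"
  shows "eval (Inp (Bin Add e (Num 2))) M = off (Suc a)"
proof -
  have "a + 2 < W" using assms word(5) n_pos by simp
  then have "eval (Bin Add e (Num 2)) M = a + 2" using assms by (simp add: eval_Add eval_Num)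
  moreover have "a + 2 < length X" using assms by (simp add: encode_adjacency_nth length_A)
  ultimately show ?thesis
    using encode_adjacency_nth(2)[of "Suc a" A] assms by (simp add: off_def length_A)
qed

lemma w_pos: "0 < w"
  using word(2) by simp

text \<open>\<open>Q\<close> is demanded for all \<open>z\<close> and \<open>k\<close>, so callers
  need not know what remains in the auxiliary variables.\<close>

lemma wp_emit:
  assumes a: "a < 20" "a \<notin> {vq, vk, vz}" and M: "M a < n" "M vy < n" "M vn = n"
    and q: "base \<le> M vq" "M vq < base + D * N + 1"
    and Q: "\<And>z k. Q ((M(vz := z, vk := k))(M vq := edge_id n (M a) (M vy), vq := M vq + 1))"
  shows "wp (emit a) Q M"
proof -
  let ?k = "of_bool (M a < M vy) :: nat"
  let ?z = "min (M a) (M vy)"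
  have b: "M a < W" "M vy < W" "M a + M vy < W" using M word(5) by linarith+
  have sel: "eval (sel (Var vk) (Var a) (Var vy)) (M(vk := ?k)) = ?z"
    using a b w_pos by (subst eval_sel) auto
  let ?e = "Bin Add (Bin Mul (Var vz) (Var vn)) (Bin Sub (Bin Add (Var a) (Var vy)) (Var vz))"
  let ?M = "M(vk := ?k, vz := ?z)"
  have less: "edge_id n (M a) (M vy) < W"
    using edge_id_less[OF M(1,2)] word(4) by simp
  have id: "?z * n + (M a + M vy - ?z) = edge_id n (M a) (M vy)"
    by (simp add: edge_id_def min_def max_def)
  have sub: "eval (Bin Sub (Bin Add (Var a) (Var vy)) (Var vz)) ?M = M a + M vy - ?z"
    using a b by (subst eval_Sub) (auto simp: eval_Add)
  have mul: "eval (Bin Mul (Var vz) (Var vn)) ?M = ?z * n"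
    using a M(3) id less by (subst eval_Mul) auto
  have store: "eval ?e ?M = edge_id n (M a) (M vy)"
    using sub mul id less by (subst eval_Add) auto
  have q': "avail (M vq)" "M vq + 1 < W" "M vq \<noteq> vq"
    using q mem word(1) by (auto simp: avail_def)
  have "(M(vk := ?k, vz := ?z))(M vq := x, vq := y) = (M(vz := ?z, vk := ?k))(M vq := x, vq := y)" for x y
    by (auto simp: fun_eq_iff)
  then have Q': "Q ((M(vk := ?k, vz := ?z))(M vq := edge_id n (M a) (M vy), vq := M vq + 1))"
    using Q[of ?z ?k] by simp
  show ?thesis
    using a sel store q' Q'
    by (simp add: emit_def incr_def eval_simps safe_sel eval_Add eval_Num)
qed

lemma wp_side:
  assumes a: "a < 20" "a \<notin> {vq, vk, vz, vy, vj}" and b: "b < 20" "b \<notin> {vq, vk, vz, vy, vj}"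
    and M: "{M a, M b} \<in> E" "M vn = n" "M vj < d"
    and q: "base \<le> M vq" "M vq < base + D * N + 1"
    and Q: "\<And>z k y. Q ((M(vz := z, vk := k, vy := y))
      (M vq := edge_id n (M a) (other_end A (M a) (M b) (M vj)), vq := M vq + 1))"
  shows "wp (side a b) Q M"
proof -
  note ab = edge_bounds[OF M(1)]
  let ?z = "off (M a) + M vj" and ?y = "other_end A (M a) (M b) (M vj)"
  let ?k = "of_bool (M vj < length (A ! M a)) :: nat"
  have y: "?y < n" using edge_bounds[OF other_end_edge[OF M(1)]] by simp
  have zW: "?z < W" using off_le[of "M a"] word(6) M(3) by simp
  have z: "eval (Bin Add (Inp (Bin Add (Var a) (Num 1))) (Var vj)) M = ?z"
    using zW eval_offset[of "Var a" M "M a"] ab by (subst eval_Add) auto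
  let ?M = "M(vz := ?z)"
  have k: "eval (Bin Lt (Var vz) (Inp (Bin Add (Var a) (Num 2)))) ?M = ?k"
    using eval_offset_next[of "Var a" ?M "M a"] ab a off_Suc[of "M a"] by (simp add: eval_simps)
  let ?M2 = "?M(vk := ?k)"
  have inp: "eval (Inp (Var vz)) ?M2 = ?y" if "M vj < length (A ! M a)"
  proof -
    have "?z < length X" using off_le[of "Suc (M a)"] off_Suc[of "M a"] ab that by simp
    then show ?thesis
      using encode_adjacency_nth(3)[of "M a" A "M vj"] ab that
      by (simp add: off_def other_end_def length_A)
  qed
  have yW: "?y < W" "M b < W" using y ab word(5) by linarith+
  have sel: "eval (sel (Var vk) (Inp (Var vz)) (Var b)) ?M2 = ?y"
  proof (cases "M vj < length (A ! M a)")
    case True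
    then show ?thesis using inp[OF True] yW w_pos by (subst eval_sel) auto
  next
    case False
    then show ?thesis using yW w_pos b by (subst eval_sel) (auto simp: other_end_def)
  qed
  have "wp (emit a) Q (?M2(vy := ?y))"
  proof (rule wp_emit)
    fix z k
    have "?M2(vy := ?y, vz := z, vk := k) = M(vz := z, vk := k, vy := ?y)"
      by (auto simp: fun_eq_iff)
    then show "Q ((?M2(vy := ?y, vz := z, vk := k))
      ((?M2(vy := ?y)) vq := edge_id n ((?M2(vy := ?y)) a) ((?M2(vy := ?y)) vy), vq := (?M2(vy := ?y)) vq + 1))"
      using Q[of z k ?y] a by simp
  qed (use a ab y M q in auto)
  then show ?thesis
    using a b z k sel by (simp add: side_def safe_sel)
qed

definition stored :: "(nat \<Rightarrow> nat) \<Rightarrow> nat \<Rightarrow> mem \<Rightarrow> bool" where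
  "stored f m M \<longleftrightarrow> (\<forall>t<m. M (base + t) = f t)"

lemma stored_upd [simp]: "i < base \<Longrightarrow> stored f m (M(i := x)) = stored f m M"
  by (auto simp: stored_def)

lemma stored_snoc: "stored f m M \<Longrightarrow> stored f (Suc m) (M(base + m := f m))"
  by (auto simp: stored_def less_Suc_eq)

definition params :: "mem \<Rightarrow> bool" where
  "params M \<longleftrightarrow> M vn = n \<and> M ve = base + N"

lemma params_upd [simp]: "i \<notin> {vn, ve} \<Longrightarrow> params (M(i := x)) = params M"
  by (auto simp: params_def)

lemma child_index: "i < N \<Longrightarrow> j < D \<Longrightarrow> D * i + 1 + j < D * N + 1"
proof -
  assume "i < N" "j < D"
  then have "D * (i + 1) \<le> D * N" by (intro mult_left_mono) simp_all
  with \<open>j < D\<close> show ?thesis by simp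
qed

lemma triple_fill_inner:
  assumes i: "i < N"
  shows "triple (\<lambda>M. params M \<and> M vb = 2 * L \<and> M vi = base + i \<and> M va = tree i div n \<and> M vo = tree i mod n \<and>
      M vj = 0 \<and> M vq = base + (D * i + 1) \<and> stored tree (D * i + 1) M)
    (While (Bin Lt (Var vj) (Num d)) (side va vo ;; side vo va ;; incr vj)) (Suc d * 220)
    (\<lambda>M. params M \<and> M vb = 2 * L \<and> M vi = base + i \<and> M vq = base + (D * i + 1 + D) \<and> stored tree (D * i + 1 + D) M)"
proof -
  let ?I = "\<lambda>k M. params M \<and> M vb = 2 * L \<and> M vi = base + i \<and> M va = tree i div n \<and> M vo = tree i mod n \<and>
      k \<le> d \<and> M vj = d - k \<and> M vq = base + (D * i + 1 + 2 * (d - k)) \<and> stored tree (D * i + 1 + 2 * (d - k)) M"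
  obtain a b where ab: "a < b" "{a, b} \<in> E" "tree i = edge_id n a b"
    using edge_ids_cases[OF tree_edge_ids] by blast
  have dm: "tree i div n = a" "tree i mod n = b"
    using ab edge_bounds[OF ab(2)] by (simp_all add: edge_id_eq)
  have body: "triple (?I (Suc k)) (side va vo ;; side vo va ;; incr vj) 200 (?I k)" for k
  proof (rule triple_straight)
    fix M assume I: "?I (Suc k) M"
    let ?j = "d - Suc k" and ?m = "D * i + 1 + 2 * (d - Suc k)"
    have j: "?j < d" "d - k = Suc ?j" using I by auto
    have m: "?m + 1 < D * N + 1" using child_index[OF i, of "2 * ?j + 1"] j by simp
    \<comment> \<open>Slot \<open>2 * ?j\<close> is even and belongs to the smaller end
      \<open>a\<close>; the slot after it is odd and belongs to \<open>b\<close>.\<close>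
    have t1: "tree ?m = edge_id n a (other_end A a b ?j)"
      using heap_child[of "2 * ?j" D nbr "edge_id n u v" i] j ab nbr_edge_id[OF ab(1,2)]
      by (simp add: tree_def)
    have t2: "tree (Suc ?m) = edge_id n b (other_end A b a ?j)"
      using heap_child[of "2 * ?j + 1" D nbr "edge_id n u v" i] j ab nbr_edge_id[OF ab(1,2)]
      by (simp add: tree_def)
    show "wp (side va vo ;; side vo va ;; incr vj) (?I k) M"
      unfolding wp.simps
    proof (rule wp_side)
      fix z k' y
      let ?M = "(M(vz := z, vk := k', vy := y))
        (M vq := edge_id n (M va) (other_end A (M va) (M vo) (M vj)), vq := M vq + 1)"
      have M: "?M = M(vz := z, vk := k', vy := y, base + ?m := tree ?m, vq := base + Suc ?m)"
        using I dm t1 by (simp add: fun_eq_iff)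
      define M1 where "M1 = ?M"
      have s1: "stored tree (Suc ?m) M1"
        unfolding M1_def M using I by (subst stored_upd, simp, intro stored_snoc) simp
      have c: "M1 va = a" "M1 vo = b" "M1 vj = ?j" "M1 vq = base + Suc ?m" "M1 vi = base + i"
          "M1 vb = 2 * L" "params M1"
        using I dm unfolding M1_def M by simp_all
      have "wp (side vo va) (wp (incr vj) (?I k)) M1"
      proof (rule wp_side)
        fix z k' y
        let ?M' = "(M1(vz := z, vk := k', vy := y))
          (M1 vq := edge_id n (M1 vo) (other_end A (M1 vo) (M1 va) (M1 vj)), vq := M1 vq + 1)"
        have M': "?M' = M1(vz := z, vk := k', vy := y, base + Suc ?m := tree (Suc ?m), vq := base + Suc (Suc ?m))"
          unfolding c t2 by simp
        define M2 where "M2 = ?M'"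
        have s2: "stored tree (Suc (Suc ?m)) M2"
          unfolding M2_def M' by (subst stored_upd, simp, intro stored_snoc) (use s1 in simp)
        have c': "M2 va = a" "M2 vo = b" "M2 vj = ?j" "M2 vq = base + Suc (Suc ?m)" "M2 vi = base + i"
          "M2 vb = 2 * L" "params M2"
          unfolding M2_def M' using c by simp_all
        have "?j + 1 < W" using j word(7) by simp
        then have "wp (incr vj) (?I k) M2"
          using c' s2 j dm I by (simp add: incr_def eval_Add eval_Num)
        then show "wp (incr vj) (?I k) ?M'"
          by (simp only: M2_def)
      qed (use c ab j m in \<open>auto simp: insert_commute params_def\<close>)
      then show "wp (side vo va) (wp (incr vj) (?I k)) ?M"
        by (simp only: M1_def)
    qed (use I dm ab j m in \<open>auto simp: params_def\<close>)
  qed (simp_all add: side_def emit_def incr_def sel_def)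
  show ?thesis
    by (rule triple_loop[where I = ?I and T = 200 and k = d, OF _ _ body])
      (use word(7) in \<open>auto simp: eval_simps eval_Num\<close>)
qed


lemma N_less: "base + N < W"
proof -
  have "N \<le> D * N" using d_pos by simp
  then show ?thesis using word(1) by linarith
qed

lemma avail_array: "t < D * N + 1 \<Longrightarrow> avail (base + t)"
  using mem by (simp add: avail_def)

lemma triple_fill:
  "triple (\<lambda>M. params M \<and> M vb = 2 * L \<and> M vq = base + 1 \<and> stored tree 1 M) (fill d)
    (Suc N * (Suc d * 400)) (\<lambda>M. params M \<and> M vb = 2 * L \<and> stored tree (D * N + 1) M)"
proof -
  let ?I = "\<lambda>k M. params M \<and> M vb = 2 * L \<and> k \<le> N \<and> M vi = base + (N - k) \<and>
    M vq = base + (D * (N - k) + 1) \<and> stored tree (D * (N - k) + 1) M"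
  have body: "triple (?I (Suc k)) (fill_step d) (Suc d * 300) (?I k)" for k
  proof (cases "Suc k \<le> N")
    case True
    define i where "i = N - Suc k"
    have i: "i < N" "N - k = Suc i" "N - Suc k = i" "k \<le> N" using True by (auto simp: i_def)
    let ?P = "\<lambda>M. params M \<and> M vb = 2 * L \<and> M vi = base + i \<and> M va = tree i div n \<and> M vo = tree i mod n \<and>
      M vj = 0 \<and> M vq = base + (D * i + 1) \<and> stored tree (D * i + 1) M"
    \<comment> \<open>A parent precedes its first child, so it is among the positions already
      stored.\<close>
    have "i \<le> D * i" using d_pos by simp
    then have lt: "i < D * i + 1" by linarith
    have "i < D * N + 1"
      using child_index[OF i(1), of 0, unfolded add_0_right] d_pos lt by linarith
    then have av: "avail (base + i)" by (rule avail_array)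
    have 1: "triple (?I (Suc k)) (Asg vx (Ld (Var vi)) ;; Asg va (Bin Div (Var vx) (Var vn)) ;;
        Asg vo (Bin Mod (Var vx) (Var vn)) ;; Asg vj (Num 0)) 30 ?P"
    proof (rule triple_straight)
      fix M assume I: "?I (Suc k) M"
      then have "stored tree (D * i + 1) M" by (simp only: i(3))
      then have "M (base + i) = tree i" using lt unfolding stored_def by blast
      then show "wp (Asg vx (Ld (Var vi)) ;; Asg va (Bin Div (Var vx) (Var vn)) ;;
        Asg vo (Bin Mod (Var vx) (Var vn)) ;; Asg vj (Num 0)) ?P M"
        using I av i by (auto simp: eval_simps eval_Num params_def)
    qed simp_all
    let ?Q = "\<lambda>M. params M \<and> M vb = 2 * L \<and> M vi = base + i \<and> M vq = base + (D * i + 1 + D) \<and> stored tree (D * i + 1 + D) M"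
    have 3: "triple ?Q (incr vi) 20 (?I k)"
    proof (rule triple_straight)
      fix M assume Q: "?Q M"
      have "base + i + 1 < W" using N_less i by simp
      moreover have "D * (N - k) + 1 = D * i + 1 + D" using i(2) by simp
      ultimately show "wp (incr vi) (?I k) M"
        using Q i by (simp add: incr_def eval_Add eval_Num algebra_simps)
    qed (simp_all add: incr_def)
    show ?thesis
      unfolding fill_step_def
      by (rule triple_conseq[OF triple_Seq[OF 1 triple_Seq[OF triple_fill_inner[OF i(1)] 3]]]) auto
  next
    case False
    then show ?thesis by (auto simp: triple_def)
  qed
  have loop: "triple (?I N) (While (Bin Lt (Var vi) (Var ve)) (fill_step d)) (Suc N * (Suc d * 320))
    (\<lambda>M. params M \<and> M vb = 2 * L \<and> stored tree (D * N + 1) M)"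
    by (rule triple_loop[where I = ?I and T = "Suc d * 300" and k = N, OF _ _ body])
      (auto simp: eval_simps params_def)
  have init: "triple (\<lambda>M. params M \<and> M vb = 2 * L \<and> M vq = base + 1 \<and> stored tree 1 M) (Asg vi (Num base)) 10 (?I N)"
    by (rule triple_straight) (auto simp: eval_Num)
  show ?thesis
    unfolding fill_def
    by (rule triple_conseq[OF triple_Seq[OF init loop]], assumption, assumption,
      rule add_Suc_mult_le, simp)
qed


section \<open>The colouring rounds\<close>

abbreviation b_of :: "nat \<Rightarrow> nat" where "b_of \<equiv> width D L"
abbreviation l_of :: "nat \<Rightarrow> nat" where "l_of r \<equiv> floorlog 2 (2 * b_of r)"

definition arr :: "nat \<Rightarrow> nat \<Rightarrow> nat" where
  "arr = sweep D L nbr N (edge_id n u v)"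

lemma arr_0: "arr 0 = tree"
  by (simp add: arr_def tree_def fun_eq_iff)

lemma arr_Suc: "arr (Suc r) i = (if i < N then refine D (b_of r) (arr r i) (\<lambda>j. arr r (D * i + 1 + j)) else arr r i)"
  by (simp add: arr_def)

lemma L_pos: "0 < L"
  using n_pos by (simp add: floorlog_def)

lemma b_pos: "0 < b_of r"
  using width_pos d_pos L_pos by simp

text \<open>Includes the meaningless positions: the packing bound holds whatever colours are packed,
  so no garbage can overflow.\<close>

lemma arr_less: "r \<le> 3 \<Longrightarrow> arr r i < W"
proof (induction r arbitrary: i)
  case 0
  then show ?case
    using edge_ids_less[OF tree_edge_ids[of i]] word(4) by (simp add: arr_0)
next
  case (Suc r)
  have "refine D (b_of r) x ys < W" for x ys
  proof -
    have "refine D (b_of r) x ys < 2 ^ (D * l_of r)"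
      by (rule refine_less[OF b_pos])
    also have "\<dots> = 2 ^ b_of (Suc r)" by simp
    also have "\<dots> \<le> W"
      using width(1)[OF Suc.prems] by (intro power_increasing) simp_all
    finally show ?thesis .
  qed
  then show ?case using Suc by (simp add: arr_Suc)
qed

text \<open>\<open>low\<close> is tail recursive, so an iteration is one unfolding, with
  \<open>vy\<close> and \<open>vk\<close> as its first two arguments.\<close>

lemma triple_low:
  assumes P: "\<And>M x y z. P M \<Longrightarrow> P (M(vy := x, va := y, vk := z))"
    and b: "b \<le> w"
  shows "triple (\<lambda>M. P M \<and> M vz = z \<and> M vk = 0 \<and> M vy = b) low_loop (Suc w * 80)
    (\<lambda>M. P M \<and> M vk = low b 0 z)"
proof -
  let ?I = "\<lambda>k M. P M \<and> M vz = z \<and> k \<le> w \<and> M vy = k \<and> M vk \<le> w \<and> low k (M vk) z = low b 0 z"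
  let ?c = "Asg vy (Bin Sub (Var vy) (Num 1)) ;; Asg va (Bin And (Bin Shr (Var vz) (Var vy)) (Num 1)) ;;
    Asg vk (sel (Var va) (Var vy) (Var vk))"
  have w: "w < W" by simp
  have body: "triple (?I (Suc k)) ?c 60 (?I k)" for k
  proof (rule triple_straight)
    fix M assume I: "?I (Suc k) M"
    let ?t = "of_bool (bit z k) :: nat"
    let ?k = "if bit z k then k else M vk"
    from I have kW: "Suc k \<le> w" "Suc k < W" "M vk < W" using w by linarith+
    have 1: "eval (Bin Sub (Var vy) (Num 1)) M = k"
      using I kW by (subst eval_Sub) (auto simp: eval_Num)
    have 2: "eval (Bin And (Bin Shr (Var vz) (Var vy)) (Num 1)) (M(vy := k)) = ?t"
      using I w_pos by (simp add: eval_bit)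
    have 3: "eval (sel (Var va) (Var vy) (Var vk)) (M(vy := k, va := ?t)) = ?k"
      using I kW w_pos by (subst eval_sel) auto
    show "wp ?c (?I k) M"
      using I P[of M k ?t ?k] 1 2 3 by (simp add: safe_sel)
  qed (simp_all add: sel_def)
  show ?thesis
    unfolding low_loop_def
    by (rule triple_loop[where I = ?I and T = 60 and k = b, OF _ _ body]) (use b in auto)
qed

text \<open>Partial results are no wider than the finished colour, so shifting in the digits loses
  no bits.\<close>

lemma shift_bound:
  assumes "r < 3" "j < D" "\<forall>j. g j < 2 ^ l_of r"
  shows "pack (l_of r) g (Suc j) < W"
proof -
  have "pack (l_of r) g (Suc j) < 2 ^ (Suc j * l_of r)"
    using assms by (intro pack_less) auto
  also have "\<dots> \<le> 2 ^ (D * l_of r)"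
    using assms(2) by (intro power_increasing mult_right_mono) auto
  also have "\<dots> = 2 ^ b_of (Suc r)" by simp
  also have "\<dots> \<le> W"
    using width(1)[of "Suc r"] assms(1) by (intro power_increasing) simp_all
  finally show ?thesis .
qed

definition in_round :: "nat \<Rightarrow> mem \<Rightarrow> bool" where
  "in_round r M \<longleftrightarrow> params M \<and> M vb = b_of r \<and> M vl = l_of r"

lemma in_round_upd [simp]: "i \<notin> {vn, ve, vb, vl} \<Longrightarrow> in_round r (M(i := x)) = in_round r M"
  by (simp add: in_round_def)

text \<open>\<open>f\<close> is the partly overwritten array; it only has to agree with round
  \<open>r\<close> on the children of \<open>i\<close>.\<close>

lemma triple_digit:
  assumes r: "r < 3" and i: "i < N" and j: "j < D"
    and f: "\<And>j. j < D \<Longrightarrow> f (D * i + 1 + j) = arr r (D * i + 1 + j)"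
  defines "g \<equiv> \<lambda>j. digit (b_of r) (arr r i) (arr r (D * i + 1 + j))"
  shows "triple (\<lambda>M. in_round r M \<and> M vi = base + i \<and> M vx = arr r i \<and> stored f (D * N + 1) M \<and>
      M vj = j \<and> M vq = base + (D * i + 1 + j) \<and> M vs = pack (l_of r) g j)
    digit_step (Suc w * 200)
    (\<lambda>M. in_round r M \<and> M vi = base + i \<and> M vx = arr r i \<and> stored f (D * N + 1) M \<and>
      M vj = Suc j \<and> M vq = base + (D * i + 1 + Suc j) \<and> M vs = pack (l_of r) g (Suc j))"
    (is "triple ?P _ _ ?Q")
proof -
  let ?x = "arr r i" and ?y = "arr r (D * i + 1 + j)"
  let ?z = "Bit_Operations.xor ?x ?y"
  have g: "g j < 2 ^ l_of r" for j
    unfolding g_def by (rule digit_less_power[OF b_pos])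
  have ci: "D * i + 1 + j < D * N + 1" by (rule child_index[OF i j])
  have 1: "triple ?P (Asg vz (Bin Xor (Var vx) (Ld (Var vq))) ;; Asg vk (Num 0) ;; Asg vy (Var vb)) 30
      (\<lambda>M. ?P M \<and> M vz = ?z \<and> M vk = 0 \<and> M vy = b_of r)"
  proof (rule triple_straight)
    fix M assume P: "?P M"
    then have "M (base + (D * i + 1 + j)) = ?y" using ci f[OF j] unfolding stored_def by metis
    then show "wp (Asg vz (Bin Xor (Var vx) (Ld (Var vq))) ;; Asg vk (Num 0) ;; Asg vy (Var vb))
        (\<lambda>M. ?P M \<and> M vz = ?z \<and> M vk = 0 \<and> M vy = b_of r) M"
      using P avail_array[OF ci] by (simp add: eval_simps eval_Num in_round_def)
  qed simp_all
  have 2: "triple (\<lambda>M. ?P M \<and> M vz = ?z \<and> M vk = 0 \<and> M vy = b_of r) low_loop (Suc w * 80)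
      (\<lambda>M. ?P M \<and> M vk = low (b_of r) 0 ?z)"
    by (rule triple_low) (use width(1)[of r] r in auto)
  let ?c = "Asg vs (Bin Add (Bin Shl (Var vs) (Var vl))
       (Bin Add (Bin Mul (Num 2) (Var vk)) (Bin And (Bin Shr (Var vx) (Var vk)) (Num 1))))"
  have 3: "triple (\<lambda>M. ?P M \<and> M vk = low (b_of r) 0 ?z) (?c ;; incr vq ;; incr vj) 60 ?Q"
  proof (rule triple_straight)
    fix M assume P: "?P M \<and> M vk = low (b_of r) 0 ?z"
    let ?k = "low (b_of r) 0 ?z"
    have p: "pack (l_of r) g j * 2 ^ l_of r + g j < W"
      using shift_bound[OF r j, of g] g by simp
    have gj: "g j = 2 * ?k + of_bool (bit ?x ?k)"
      by (simp add: g_def digit_def Let_def)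
    have e1: "eval (Bin Shl (Var vs) (Var vl)) M = pack (l_of r) g j * 2 ^ l_of r"
      using P p by (subst eval_Shl) (auto simp: in_round_def)
    have e2: "eval (Bin Mul (Num 2) (Var vk)) M = 2 * ?k"
      using P p gj by (subst eval_Mul) (auto simp: eval_Num)
    have e3: "eval (Bin And (Bin Shr (Var vx) (Var vk)) (Num 1)) M = of_bool (bit ?x ?k)"
      using P w_pos by (simp add: eval_bit)
    have e4: "eval (Bin Add (Bin Mul (Num 2) (Var vk)) (Bin And (Bin Shr (Var vx) (Var vk)) (Num 1))) M = g j"
      using e2 e3 p gj by (subst eval_Add) auto
    have e: "eval (Bin Add (Bin Shl (Var vs) (Var vl))
       (Bin Add (Bin Mul (Num 2) (Var vk)) (Bin And (Bin Shr (Var vx) (Var vk)) (Num 1)))) M = pack (l_of r) g (Suc j)"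
      using e1 e4 p by (subst eval_Add) auto
    have "base + (D * i + 1 + j) + 1 < W" "j + 1 < W" using ci word(1,7) j by linarith+
    then show "wp (?c ;; incr vq ;; incr vj) ?Q M"
      using P e by (simp add: incr_def eval_Add eval_Num)
  qed (simp_all add: incr_def)
  show ?thesis
    unfolding digit_step_def
    by (rule triple_conseq[OF triple_Seq[OF 1 triple_Seq[OF 2 3]]]) auto
qed

lemma triple_round_step:
  assumes r: "r < 3" and i: "i < N"
  defines "F \<equiv> \<lambda>m t. if t < m then arr (Suc r) t else arr r t"
  shows "triple (\<lambda>M. in_round r M \<and> M vi = base + i \<and> M vq = base + (D * i + 1) \<and> stored (F i) (D * N + 1) M)
    (round_step D) (Suc D * (Suc w * 300))
    (\<lambda>M. in_round r M \<and> M vi = base + Suc i \<and> M vq = base + (D * Suc i + 1) \<and> stored (F (Suc i)) (D * N + 1) M)"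
    (is "triple ?P _ _ ?Q")
proof -
  define g where "g = (\<lambda>j. digit (b_of r) (arr r i) (arr r (D * i + 1 + j)))"
  have "i \<le> D * i" using d_pos by simp
  then have lt: "i < D * i + 1" by linarith
  have "i < D * N + 1" using child_index[OF i, of 0, unfolded add_0_right] d_pos lt by linarith
  note av = avail_array[OF this] and ltN = this
  have f: "F i (D * i + 1 + j) = arr r (D * i + 1 + j)" for j
    using lt by (simp add: F_def)
  let ?J = "\<lambda>j M. in_round r M \<and> M vi = base + i \<and> M vx = arr r i \<and> stored (F i) (D * N + 1) M \<and>
      M vj = j \<and> M vq = base + (D * i + 1 + j) \<and> M vs = pack (l_of r) g j"
  let ?I = "\<lambda>k M. k \<le> D \<and> ?J (D - k) M"
  have 1: "triple ?P (Asg vx (Ld (Var vi)) ;; Asg vs (Num 0) ;; Asg vj (Num 0)) 30 (?J 0)"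
  proof (rule triple_straight)
    fix M assume P: "?P M"
    then have "M (base + i) = F i i" using ltN unfolding stored_def by metis
    then have "M (base + i) = arr r i" by (simp add: F_def)
    then show "wp (Asg vx (Ld (Var vi)) ;; Asg vs (Num 0) ;; Asg vj (Num 0)) (?J 0) M"
      using P av by (simp add: eval_simps eval_Num)
  qed simp_all
  have body: "triple (?I (Suc k)) digit_step (Suc w * 200) (?I k)" for k
  proof (cases "Suc k \<le> D")
    case True
    then have j: "D - Suc k < D" "Suc (D - Suc k) = D - k" by auto
    show ?thesis
      by (rule triple_conseq[OF triple_digit[OF r i j(1) f]]) (use True in \<open>simp_all add: j(2) g_def\<close>)
  next
    case False
    then show ?thesis by (auto simp: triple_def)
  qed
  have 2: "triple (?J 0) (While (Bin Lt (Var vj) (Num D)) digit_step) (Suc D * (Suc w * 220)) (?J D)"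
    by (rule triple_loop[where I = ?I and T = "Suc w * 200" and k = D, OF _ _ body])
      (use word(7) in \<open>auto simp: eval_simps eval_Num\<close>)
  have 3: "triple (?J D) (Sto (Var vi) (Var vs) ;; incr vi) 30 ?Q"
  proof (rule triple_straight)
    fix M assume J: "?J D M"
    have "base + i + 1 < W" using N_less i by simp
    moreover have "pack (l_of r) g D = arr (Suc r) i"
      using i by (simp add: arr_Suc refine_def g_def)
    moreover have "stored (F (Suc i)) (D * N + 1) (M(base + i := arr (Suc r) i))"
      using J by (auto simp: stored_def F_def)
    ultimately show "wp (Sto (Var vi) (Var vs) ;; incr vi) ?Q M"
      using J av by (simp add: incr_def eval_Add eval_Num algebra_simps)
  qed (simp_all add: incr_def)
  show ?thesis
    unfolding round_step_def
  proof (rule triple_conseq[OF triple_Seq[OF 1 triple_Seq[OF 2 3]]])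
    have "60 + Suc D * (Suc w * 220) \<le> Suc D * (Suc w * 300)"
      by (rule add_Suc_mult_le) simp
    then show "30 + (Suc D * (Suc w * 220) + 30) \<le> Suc D * (Suc w * 300)" by linarith
  qed
qed

text \<open>The final values of \<open>vi\<close> and \<open>vq\<close> are recorded because
  settling starts from them.\<close>

lemma triple_round:
  assumes r: "r < 3"
  shows "triple (\<lambda>M. params M \<and> M vb = b_of r \<and> stored (arr r) (D * N + 1) M)
    (round D) (Suc N * (Suc D * (Suc w * 600)))
    (\<lambda>M. params M \<and> M vb = b_of (Suc r) \<and> M vi = base + N \<and> M vq = base + (D * N + 1) \<and>
      stored (arr (Suc r)) (D * N + 1) M)"
    (is "triple ?P _ _ ?Q")
proof -
  let ?F = "\<lambda>m t. if t < m then arr (Suc r) t else arr r t"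
  let ?K = "\<lambda>i M. in_round r M \<and> M vi = base + i \<and> M vq = base + (D * i + 1) \<and> stored (?F i) (D * N + 1) M"
  let ?I = "\<lambda>k M. k \<le> N \<and> ?K (N - k) M"
  let ?e = "Bin Mul (Num 2) (Var vb)"
  have b2: "2 * b_of r < W" using width(2) r by simp
  have "l_of r \<le> D * l_of r" using d_pos by simp
  also have "\<dots> = b_of (Suc r)" by simp
  also have "\<dots> < w" using width(1)[of "Suc r"] r by simp
  finally have lw: "l_of r < w" .
  have 1: "triple ?P (bitlen ?e) (100 * Suc w) (\<lambda>M. ?P M \<and> M vl = l_of r)"
    by (rule triple_bitlen) (use b2 lw word(2) in \<open>auto simp: eval_Mul eval_Num\<close>)
  have 2: "triple (\<lambda>M. ?P M \<and> M vl = l_of r) (Asg vi (Num base) ;; Asg vq (Num (base + 1))) 30 (?K 0)"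
    by (rule triple_straight) (auto simp: eval_Num in_round_def stored_def)
  have body: "triple (?I (Suc k)) (round_step D) (Suc D * (Suc w * 300)) (?I k)" for k
  proof (cases "Suc k \<le> N")
    case True
    then have i: "N - Suc k < N" "Suc (N - Suc k) = N - k" by auto
    show ?thesis
      by (rule triple_conseq[OF triple_round_step[OF r i(1)]]) (use True in \<open>simp_all add: i(2)\<close>)
  next
    case False
    then show ?thesis by (auto simp: triple_def)
  qed
  have 3: "triple (?K 0) (While (Bin Lt (Var vi) (Var ve)) (round_step D)) (Suc N * (Suc D * (Suc w * 320))) (?K N)"
  proof (rule triple_loop[where I = ?I and T = "Suc D * (Suc w * 300)" and k = N, OF _ _ body])
    have "20 + Suc D * (Suc w * 300) \<le> Suc D * (Suc w * 320)"
      by (intro add_Suc_mult_le) simp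
    then show "Suc D * (Suc w * 300) + 20 \<le> Suc D * (Suc w * 320)" by linarith
  qed (auto simp: eval_simps in_round_def params_def)
  \<comment> \<open>\<open>sweep\<close> leaves the positions from \<open>N\<close> on alone, so the
    round is complete here.\<close>
  have FN: "?F N = arr (Suc r)"
    by (auto simp: arr_Suc)
  have 4: "triple (?K N) (Asg vb (Bin Mul (Num D) (Var vl))) 30 ?Q"
  proof (rule triple_straight)
    fix M assume K: "?K N M"
    have "D * l_of r < W"
      using less_trans[OF width(1)[of "Suc r"] less_exp] r by simp
    then show "wp (Asg vb (Bin Mul (Num D) (Var vl))) ?Q M"
      using K word(7) unfolding FN by (simp add: eval_Mul eval_Num in_round_def)
  qed simp_all
  show ?thesis
    unfolding round_def
  proof (rule triple_conseq[OF triple_Seq[OF 1 triple_Seq[OF 2 triple_Seq[OF 3 4]]]])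
    have "(100 * Suc w + 60) + Suc N * (Suc D * (Suc w * 320)) \<le> Suc N * (Suc D * (Suc w * 600))"
      by (rule add_Suc_mult_le, rule add_Suc_mult_le) simp
    then show "100 * Suc w + (30 + (Suc N * (Suc D * (Suc w * 320)) + 30)) \<le> Suc N * (Suc D * (Suc w * 600))"
      by linarith
  qed
qed


section \<open>Settling the matching\<close>

definition final :: "nat \<Rightarrow> nat" where
  "final = settle D N (W - 1) (arr 3)"

lemma final_eq:
  "final i = (if i < N \<and> (\<exists>j<D. final (D * i + 1 + j) < arr 3 i) then W - 1 else arr 3 i)"
  unfolding final_def by (subst settle.simps) auto

lemma triple_settle_step:
  assumes i: "i < N"
  defines "F \<equiv> \<lambda>m t. if t < m then arr 3 t else final t"
  shows "triple (\<lambda>M. M vi = base + Suc i \<and> M vq = base + (D * Suc i + 1) \<and> stored (F (Suc i)) (D * N + 1) M)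
    (settle_step D) (Suc D * 100)
    (\<lambda>M. M vi = base + i \<and> M vq = base + (D * i + 1) \<and> stored (F i) (D * N + 1) M)"
    (is "triple ?P _ _ ?Q")
proof -
  have "i \<le> D * i" using d_pos by simp
  then have lt: "i < D * i + 1" by linarith
  have ltN: "i < D * N + 1" using child_index[OF i, of 0, unfolded add_0_right] d_pos lt by linarith
  note av = avail_array[OF ltN]
  let ?x = "arr 3 i"
  \<comment> \<open>Children are visited from the last to the first, so the flag speaks about those
    of index at least \<open>j\<close>; \<open>vj\<close> merely counts iterations.\<close>
  let ?B = "\<lambda>j. \<exists>m<D. j \<le> m \<and> final (D * i + 1 + m) < ?x"
  let ?J = "\<lambda>k M. M vi = base + i \<and> M vx = ?x \<and> stored (F (Suc i)) (D * N + 1) M \<and>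
      M vj = D - k \<and> M vq = base + (D * i + 1 + k) \<and> M vs = of_bool (?B k)"
  let ?I = "\<lambda>k M. k \<le> D \<and> ?J k M"
  let ?c1 = "Asg vi (Bin Sub (Var vi) (Num 1)) ;; Asg vx (Ld (Var vi)) ;; Asg vs (Num 0) ;; Asg vj (Num 0)"
  have 1: "triple ?P ?c1 30 (?J D)"
  proof (rule triple_straight)
    fix M assume P: "?P M"
    then have "M (base + i) = F (Suc i) i" using ltN unfolding stored_def by metis
    then have x: "M (base + i) = ?x" by (simp add: F_def)
    have "base + Suc i < W" using N_less i by linarith
    then have e: "eval (Bin Sub (Var vi) (Num 1)) M = base + i"
      using P by (subst eval_Sub) (auto simp: eval_Num)
    have "D * Suc i + 1 = D * i + 1 + D" by simp
    then show "wp ?c1 (?J D) M"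
      using P e x av by (simp add: eval_Num)
  qed simp_all
  let ?c2 = "Asg vq (Bin Sub (Var vq) (Num 1)) ;; Asg vs (Bin Or (Var vs) (Bin Lt (Ld (Var vq)) (Var vx))) ;;
        incr vj"
  have body: "triple (?I (Suc k)) ?c2 40 (?I k)" for k
  proof (rule triple_straight)
    fix M assume I: "?I (Suc k) M"
    then have k: "k < D" by simp
    let ?t = "D * i + 1 + k"
    have ci: "?t < D * N + 1" by (rule child_index[OF i k])
    have "M (base + ?t) = F (Suc i) ?t" using I ci unfolding stored_def by metis
    then have y: "M (base + ?t) = final ?t" using lt by (simp add: F_def)
    have "base + (?t + 1) < W" using ci word(1) by linarith
    then have e: "eval (Bin Sub (Var vq) (Num 1)) M = base + ?t"
      using I by (subst eval_Sub) (auto simp: eval_Num)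
    have "?B k \<longleftrightarrow> ?B (Suc k) \<or> final ?t < ?x"
      using k by (auto simp: Suc_le_eq le_less)
    then have b: "Bit_Operations.or (of_bool (?B (Suc k))) (of_bool (final ?t < ?x)) = (of_bool (?B k) :: nat)"
      by auto
    have j: "D - k = Suc (D - Suc k)" "Suc (D - Suc k) < W" using k word(7) by linarith+
    show "wp ?c2 (?I k) M"
      using I e y b j k avail_array[OF ci]
      by (simp add: incr_def eval_simps eval_Add eval_Num del: of_bool_eq_1_iff)
  qed (simp_all add: incr_def)
  have 2: "triple (?J D) (While (Bin Lt (Var vj) (Num D)) ?c2) (Suc D * 60) (?J 0)"
    by (rule triple_loop[where I = ?I and T = 40 and k = D, OF _ _ body])
      (use word(7) in \<open>auto simp: eval_simps eval_Num\<close>)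
  let ?c3 = "Sto (Var vi) (sel (Var vs) maxw (Var vx))"
  have 3: "triple (?J 0) ?c3 30 ?Q"
  proof (rule triple_straight)
    fix M assume J: "?J 0 M"
    have "eval (sel (Var vs) maxw (Var vx)) M = (if ?B 0 then W - 1 else ?x)"
      using J w_pos arr_less[of 3 i] eval_maxw[OF w_pos, of M] by (subst eval_sel) auto
    also have "\<dots> = final i" using i by (subst final_eq) auto
    finally have e: "eval (sel (Var vs) maxw (Var vx)) M = final i" .
    have "stored (F i) (D * N + 1) (M(base + i := final i))"
      using J by (auto simp: stored_def F_def)
    then show "wp ?c3 ?Q M"
      using J e av by (simp add: safe_sel)
  qed (simp_all add: sel_def)
  show ?thesis
    unfolding settle_step_def
    by (rule triple_conseq[OF triple_Seq[OF 1 triple_Seq[OF 2 3]]]) (use d_pos in auto)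
qed

lemma triple_settle:
  "triple (\<lambda>M. M vi = base + N \<and> M vq = base + (D * N + 1) \<and> stored (arr 3) (D * N + 1) M)
    (While (Bin Lt (Num base) (Var vi)) (settle_step D)) (Suc N * (Suc D * 120))
    (\<lambda>M. stored final (D * N + 1) M)"
proof -
  let ?F = "\<lambda>m t. if t < m then arr 3 t else final t"
  let ?I = "\<lambda>k M. k \<le> N \<and> M vi = base + k \<and> M vq = base + (D * k + 1) \<and> stored (?F k) (D * N + 1) M"
  have body: "triple (?I (Suc k)) (settle_step D) (Suc D * 100) (?I k)" for k
  proof (cases "Suc k \<le> N")
    case True
    then have i: "k < N" by simp
    show ?thesis
      by (rule triple_conseq[OF triple_settle_step[OF i]]) (use True in auto)
  next
    case False
    then show ?thesis by (auto simp: triple_def)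
  qed
  have "?F N = arr 3"
  proof
    show "?F N i = arr 3 i" for i by (cases "i < N") (auto simp: final_eq[of i])
  qed
  note FN = this
  show ?thesis
  proof (rule triple_loop[where I = ?I and T = "Suc D * 100" and k = N, OF _ _ body])
    show "?I N M" if "M vi = base + N \<and> M vq = base + (D * N + 1) \<and> stored (arr 3) (D * N + 1) M" for M
      using that unfolding FN by simp
  qed (auto simp: eval_simps eval_Num)
qed

lemma triple_start:
  "triple (\<lambda>M. M vU = u \<and> M vV = v)
    (Asg vn (Inp (Num 0)) ;; bitlen (Var vn) ;;
     (Asg ve (Bin Add (Num base) (Bin Mul (Num C) (Var vl))) ;; Asg vb (Bin Mul (Num 2) (Var vl)) ;;
      Asg vq (Num base) ;; Asg vy (Var vV) ;; emit vU))
    (100 * Suc w + 200)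
    (\<lambda>M. params M \<and> M vb = 2 * L \<and> M vq = base + 1 \<and> stored tree 1 M)"
proof -
  let ?P = "\<lambda>M. M vU = u \<and> M vV = v \<and> M vn = n"
  have "eval (Inp (Num 0)) M = n" for M
    by (simp add: eval_Num encode_adjacency_nth length_A)
  then have 1: "triple (\<lambda>M. M vU = u \<and> M vV = v) (Asg vn (Inp (Num 0))) 10 ?P"
    by (intro triple_straight) auto
  have "L < w" using width(1)[of 0] L_pos by simp
  then have 2: "triple ?P (bitlen (Var vn)) (100 * Suc w) (\<lambda>M. ?P M \<and> M vl = L)"
    by (intro triple_bitlen) (use word(2) in auto)
  let ?c = "Asg ve (Bin Add (Num base) (Bin Mul (Num C) (Var vl))) ;; Asg vb (Bin Mul (Num 2) (Var vl)) ;;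
      Asg vq (Num base) ;; Asg vy (Var vV) ;; emit vU"
  let ?Q = "\<lambda>M. params M \<and> M vb = 2 * L \<and> M vq = base + 1 \<and> stored tree 1 M"
  have 3: "triple (\<lambda>M. ?P M \<and> M vl = L) ?c 150 ?Q"
  proof (rule triple_straight)
    fix M assume P: "?P M \<and> M vl = L"
    have e1: "eval (Bin Mul (Num C) (Var vl)) M = N"
      using P N_less word(3) by (subst eval_Mul) (auto simp: eval_Num)
    have e2: "eval (Bin Add (Num base) (Bin Mul (Num C) (Var vl))) M = base + N"
      using e1 N_less by (subst eval_Add) (auto simp: eval_Num)
    have "2 * L < W" using width(2)[of 0] by simp
    then have e3: "eval (Bin Mul (Num 2) (Var vl)) (M(ve := base + N)) = 2 * L"
      using P by (subst eval_Mul) (auto simp: eval_Num)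
    let ?M = "M(ve := base + N, vb := 2 * L, vq := base, vy := v)"
    have "wp (emit vU) ?Q ?M"
    proof (rule wp_emit)
      fix z k
      have "tree 0 = edge_id n u v" by (simp add: tree_def)
      then show "?Q ((?M(vz := z, vk := k))(?M vq := edge_id n (?M vU) (?M vy), vq := ?M vq + 1))"
        using P by (simp add: params_def stored_def)
    qed (use P edge_bounds[OF uv] in auto)
    then show "wp ?c ?Q M"
      using P e2 e3 by (simp add: eval_Num)
  qed (simp_all add: emit_def incr_def sel_def)
  show ?thesis
    by (rule triple_conseq[OF triple_Seq[OF 1 triple_Seq[OF 2 3]]]) auto
qed

end

section \<open>Correctness of the compiled program\<close>

definition program :: "nat \<Rightarrow> nat \<Rightarrow> instr list" where
  "program d C = code (main d C) 0 @ [Halt]"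

context machine
begin

lemma triple_main:
  "triple (\<lambda>M. M vU = u \<and> M vV = v) (main d C) (Suc N * (Suc D * (Suc w * 3000)))
    (\<lambda>M. M vU = of_bool (final 0 < W - 1))"
proof -
  have 1: "triple (\<lambda>M. stored final (D * N + 1) M) (Asg vU (Bin Lt (Ld (Num base)) maxw)) 30
      (\<lambda>M. M vU = of_bool (final 0 < W - 1))"
  proof (rule triple_straight)
    fix M assume "stored final (D * N + 1) M"
    then have "M (base + 0) = final 0" unfolding stored_def by (rule allE[of _ 0]) simp
    then show "wp (Asg vU (Bin Lt (Ld (Num base)) maxw)) (\<lambda>M. M vU = of_bool (final 0 < W - 1)) M"
      using avail_array[of 0] eval_maxw[OF w_pos, of M] by (simp add: eval_simps eval_Num)
  qed simp_all
  have round: "triple (\<lambda>M. params M \<and> M vb = b_of r \<and> stored (arr r) (D * N + 1) M)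
      (round D) (Suc N * (Suc D * (Suc w * 600)))
      (\<lambda>M. params M \<and> M vb = b_of r' \<and> stored (arr r') (D * N + 1) M)"
    if "r < 3" "r' = Suc r" for r r'
    by (rule triple_conseq[OF triple_round[OF that(1)]]) (simp_all add: that(2))
  have last: "triple (\<lambda>M. params M \<and> M vb = b_of 2 \<and> stored (arr 2) (D * N + 1) M)
      (round D) (Suc N * (Suc D * (Suc w * 600)))
      (\<lambda>M. M vi = base + N \<and> M vq = base + (D * N + 1) \<and> stored (arr 3) (D * N + 1) M)"
    by (rule triple_conseq[OF triple_round[of 2]]) (simp_all add: numeral_3_eq_3 numeral_2_eq_2)
  have fill: "triple (\<lambda>M. params M \<and> M vb = 2 * L \<and> M vq = base + 1 \<and> stored tree 1 M) (fill d)
      (Suc N * (Suc d * 400)) (\<lambda>M. params M \<and> M vb = b_of 0 \<and> stored (arr 0) (D * N + 1) M)"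
    using triple_fill by (simp add: arr_0)
  \<comment> \<open>In this unit the parts cost 300 + 400 + 3 * 600 + 120 + 30 = 2650, rounded up to
    3000.\<close>
  let ?u = "Suc N * (Suc D * Suc w)"
  have time: "100 * Suc w + 200 \<le> ?u * 300" "Suc N * (Suc d * 400) \<le> ?u * 400"
    "Suc N * (Suc D * 120) \<le> ?u * 120" "30 \<le> ?u * 30"
    by (simp_all add: algebra_simps)
  show ?thesis
    unfolding main_def
    by (rule triple_conseq[OF triple_Seq[OF triple_start triple_Seq[OF fill
        triple_Seq[OF round[of 0 1] triple_Seq[OF round[of 1 2]
          triple_Seq[OF last triple_Seq[OF triple_settle 1]]]]]]])
      (use time in \<open>auto simp: algebra_simps\<close>)
qed

text \<open>\<open>M\<close> is arbitrary apart from the query, which takes care of all leftovers of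
  earlier queries.\<close>

lemma run_program:
  assumes "M vU = u" "M vV = v"
  shows "\<exists>M'. run (program d C) w S X R (Suc N * (Suc D * (Suc w * 3000))) (0, M) = Some M' \<and>
    (M' 0 \<noteq> 0 \<longleftrightarrow> final 0 < W - 1)"
proof -
  let ?p = "program d C"
  have "code_at ?p 0 (code (main d C) 0)"
    by (simp add: code_at_def program_def nth_append)
  moreover have "clear M vU = u" "clear M vV = v" using assms by (simp_all add: clear_def)
  ultimately obtain t M' where t: "t \<le> Suc N * (Suc D * (Suc w * 3000))"
    "reach ?p t (0, M) (length (code (main d C) 0), M')" "clear M' vU = of_bool (final 0 < W - 1)"
    using triple_main unfolding triple_def by (metis add_0)
  have "run ?p w S X R (t + 0) (0, M) = run ?p w S X R 0 (length (code (main d C) 0), M')"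
    using t(2) unfolding reach_def by blast
  also have "\<dots> = Some M'" by (simp add: program_def)
  finally have "run ?p w S X R t (0, M) = Some M'" by (simp only: add_0_right)
  then have "run ?p w S X R (Suc N * (Suc D * (Suc w * 3000))) (0, M) = Some M'"
    using t(1) by (rule run_more)
  moreover have "M' 0 = of_bool (final 0 < W - 1)" using t(3) by (simp add: clear_def)
  ultimately show ?thesis by auto
qed

lemma final_iff: "final 0 < W - 1 \<longleftrightarrow> {u, v} \<in> greedy (colour D L nbr 3)"
proof -
  let ?c = "colour D L nbr 3" and ?x = "edge_id n u v"
  have root0: "heap D nbr ?x 0 = ?x" by simp
  have n: "n < 2 ^ L" using floorlog_bounds[of n 2] n_pos by simp
  have less: "?c ?x < 2 ^ b_of 3"
    by (rule colour_less[OF d_pos L_pos n root])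
  \<comment> \<open>The spare bit keeps colours strictly below \<open>W - 1\<close>, so that a
    surviving colour cannot be mistaken for the rejection mark.\<close>
  also have "\<dots> \<le> 2 ^ (w - 1)"
    using width(1)[of 3] by (intro power_increasing) auto
  also have "\<dots> \<le> W - 1"
    using w_pos less_exp[of "w - 1"] by (cases w) auto
  finally have c: "?c ?x < W - 1" .
  have "(D + 1) ^ (3 + ?c ?x + 1) \<le> (D + 1) ^ (2 ^ b_of 3 + 4)"
    using less by (intro power_increasing) auto
  also have "\<dots> \<le> N" by (rule size)
  finally have "Suc 0 * (D + 1) ^ (3 + ?c (heap D nbr ?x 0) + 1) \<le> N" by simp
  then have "final 0 = (if chosen D ?c nbr (heap D nbr ?x 0) then ?c (heap D nbr ?x 0) else W - 1)"
    unfolding final_def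
  proof (rule settle_eq[where r = 3, rotated 2])
    show "arr 3 i = ?c (heap D nbr ?x i)" if "Suc i * (D + 1) ^ 3 \<le> N" for i
      unfolding arr_def by (rule sweep_eq_colour[OF that])
    show "arr 3 i \<le> W - 1" for i
      using arr_less[of 3 i] by linarith
  qed
  then show ?thesis using c greedy_iff[OF uv] by (simp del: colour.simps)
qed

end

section \<open>Input size, asymptotics and the choice of constants\<close>

lemma sum_list_le: "\<forall>x\<in>set xs. f x \<le> k \<Longrightarrow> (\<Sum>x\<leftarrow>xs. f x) \<le> length xs * k" for k :: nat
  by (induction xs) auto

context instance_graph
begin

lemma length_encode: "length (encode_adjacency A) \<le> n + 2 + n * d"
proof -
  have "\<forall>xs\<in>set A. length xs \<le> d"
    using length_adj length_A by (auto simp: in_set_conv_nth)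
  then have "length (concat A) \<le> n * d"
    using sum_list_le[of A length d] by (simp add: length_concat length_A)
  then show ?thesis by (simp add: encode_adjacency_nth length_A)
qed

lemma set_encode: "x \<in> set (encode_adjacency A) \<Longrightarrow> x \<le> length (encode_adjacency A)"
proof -
  have "length (concat (take a A)) \<le> length (concat A)" for a
    by (metis append_take_drop_id concat_append le_add1 length_append)
  moreover have "y < n" if y: "y \<in> set (concat A)" for y
  proof -
    obtain a where a: "a < n" "y \<in> set (A ! a)"
      using y by (metis UN_E in_set_conv_nth length_A set_concat)
    then have "{y, a} \<in> E" using adj by (auto simp: adjacency_lists_def)
    then show ?thesis by (rule edge_bounds)
  qed
  moreover assume "x \<in> set (encode_adjacency A)"
  ultimately show ?thesis
    by (fastforce simp: encode_adjacency_def length_A)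
qed

end

text \<open>A guarantee for single queries from every memory \<open>M\<close> passes through any
  history, because the induction generalises over the memory left behind.\<close>

lemma answers_eq_map:
  assumes "\<And>q M. q \<in> Q \<Longrightarrow> \<exists>M'. run p w S X R T (0, put_query q M) = Some M' \<and> (M' 0 \<noteq> 0 \<longleftrightarrow> y q)"
    and "qs \<in> lists Q"
  shows "answers p w S X R T M qs = Some (map y qs)"
  using assms(2)
proof (induction qs arbitrary: M)
  case (Cons q qs)
  then obtain M' where "run p w S X R T (0, put_query q M) = Some M'" "M' 0 \<noteq> 0 \<longleftrightarrow> y q"
    using assms(1)[of q M] by auto
  then show ?case using Cons by simp
qed simp

lemma bigo_log_cubed:
  assumes "\<And>L. 0 < L \<Longrightarrow> f L \<le> K * L ^ 2"
  shows "(\<lambda>n. real (f (floorlog 2 n))) \<in> O(\<lambda>n. log 2 (real n) ^ 3)"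
proof (rule bigoI)
  show "\<forall>\<^sub>F n in at_top. norm (real (f (floorlog 2 n))) \<le> (4 * K) * norm (log 2 (real n) ^ 3)"
    using eventually_ge_at_top[of 2]
  proof eventually_elim
    case (elim n)
    let ?y = "log 2 (real n)"
    have y: "1 \<le> ?y" using elim by simp
    \<comment> \<open>The rounding error is at most 1, hence at most the logarithm itself once
      \<open>n\<close> is at least 2; squaring yields the factor 4.\<close>
    have L: "real (floorlog 2 n) \<le> 2 * ?y" using floorlog_le_log[of n] elim y by linarith
    have "f (floorlog 2 n) \<le> K * floorlog 2 n ^ 2"
      using elim by (intro assms) (simp add: floorlog_def)
    then have "real (f (floorlog 2 n)) \<le> real (K * floorlog 2 n ^ 2)" by (rule of_nat_mono)
    also have "\<dots> = K * real (floorlog 2 n) ^ 2" by simp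
    also have "\<dots> \<le> K * (2 * ?y) ^ 2" using L by (intro mult_left_mono power_mono) simp_all
    also have "\<dots> = 4 * K * ?y ^ 2" by (simp add: power_mult_distrib)
    also have "\<dots> \<le> 4 * K * ?y ^ 3" using y by (intro mult_left_mono power_increasing) simp_all
    finally show ?case using y by simp
  qed
qed

theorem theorem4:
  fixes d :: nat
  shows "\<exists>(p :: instr list) (c :: nat) (t :: nat \<Rightarrow> nat) (s :: nat \<Rightarrow> nat).
           (\<lambda>n. real (t n)) \<in> O(\<lambda>n. log 2 (real n) ^ 3) \<and>
           (\<lambda>n. real (s n)) \<in> O(\<lambda>n. log 2 (real n) ^ 3) \<and>
           local_computation_algorithm t s (\<lambda>n. 1 / real n) (maximal_matching_problem d) c p"
proof -
  define D where "D = 2 * d"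
  \<comment> \<open>For \<open>d = 0\<close> there is no edge to query, and any positive
    \<open>C\<close> does.\<close>
  obtain C where C: "0 < C" "\<And>L. 0 < L \<Longrightarrow> 0 < d \<Longrightarrow> (D + 1) ^ (2 ^ width D L 3 + 4) \<le> C * L"
  proof (cases "0 < d")
    case True
    then show ?thesis using tree_size_bound[of D] that by (auto simp: D_def)
  next
    case False
    then show ?thesis using that[of 1] by simp
  qed
  \<comment> \<open>Each summand pays for one estimate: \<open>4 * (2 * D) ^ 3\<close> for the
    widths of the first three rounds, \<open>D * C\<close> for array addresses, \<open>C\<close> and
    \<open>D\<close> for the constants in the program and the input length, 100 for
    \<open>base\<close> and small terms.\<close>
  define c where "c = 4 * (2 * D) ^ 3 + D * C + C + D + 100"
  define T where "T L = Suc (C * L) * (Suc D * (Suc (c * L) * 3000))" for L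
  define S where "S L = base + D * (C * L) + 1" for L
  define t where "t n = T (floorlog 2 n)" for n
  \<comment> \<open>Space is counted in bits: \<open>S\<close> words of
    \<open>c * floorlog 2 n\<close> bits, so the division by the word size is exact.\<close>
  define s where "s n = c * floorlog 2 n * S (floorlog 2 n)" for n
  have c: "0 < c" by (simp add: c_def)
  have t: "(\<lambda>n. real (t n)) \<in> O(\<lambda>n. log 2 (real n) ^ 3)"
    unfolding t_def
  proof (rule bigo_log_cubed)
    fix L :: nat assume "0 < L"
    then have "T L \<le> (Suc C * L) * (Suc D * ((Suc c * L) * 3000))"
      unfolding T_def by (intro mult_mono) simp_all
    then show "T L \<le> (Suc C * Suc D * Suc c * 3000) * L ^ 2"
      by (simp only: power2_eq_square ac_simps)
  qed
  have s: "(\<lambda>n. real (s n)) \<in> O(\<lambda>n. log 2 (real n) ^ 3)"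
    unfolding s_def
  proof (rule bigo_log_cubed)
    fix L :: nat assume "0 < L"
    then have "S L \<le> (31 + D * C) * L" by (simp add: S_def algebra_simps)
    then have "c * L * S L \<le> c * L * ((31 + D * C) * L)" by (rule mult_left_mono) simp
    then show "c * L * S L \<le> (c * (31 + D * C)) * L ^ 2"
      by (simp only: power2_eq_square ac_simps)
  qed
  have "local_computation_algorithm t s (\<lambda>n. 1 / real n) (maximal_matching_problem d) c (program d C)"
    unfolding local_computation_algorithm_def
  proof (intro conjI c ballI)
    fix x assume x: "x \<in> instances (maximal_matching_problem d)"
    obtain n E A where xeq: "x = (n, E, A)" by (cases x)
    have inst: "0 < n" "simple_graph {..<n} E" "max_degree {..<n} E = d" "adjacency_lists n E A"
      using x by (simp_all add: xeq maximal_matching_problem_def)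
    interpret instance_graph n d E A
      by unfold_locales (use inst in auto)
    let ?L = "floorlog 2 n" and ?X = "encode_adjacency A"
    let ?w = "c * ?L"
    have L: "0 < ?L" using inst(1) by (simp add: floorlog_def)
    have n: "n < 2 ^ ?L" using floorlog_bounds[of n 2] inst(1) by simp
    have pow: "2 ^ (k * ?L) \<le> (2 :: nat) ^ ?w" if "k \<le> c" for k
      using that by (intro power_increasing mult_right_mono) auto
    have wlt: "k * ?L < 2 ^ ?w" if "k \<le> c" for k
      using mult_right_mono[OF that, of ?L] less_exp[of ?w] by linarith
    have lenX: "length ?X + d < 2 ^ ?w"
    proof -
      have "length ?X + d \<le> n * (2 * d + 3)"
        using length_encode inst(1) by (cases n) (auto simp: algebra_simps)
      also have "\<dots> < 2 ^ ?L * (2 * d + 3)" using n by simp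
      also have "\<dots> \<le> 2 ^ ?L * 2 ^ (2 * d + 3)"
        using less_exp[of "2 * d + 3"] by (intro mult_left_mono) simp_all
      also have "\<dots> \<le> 2 ^ ?L * 2 ^ ((2 * d + 3) * ?L)"
        using L by (intro mult_left_mono power_increasing) simp_all
      also have "\<dots> = 2 ^ ((2 * d + 4) * ?L)"
        by (simp add: power_add[symmetric] algebra_simps)
      also have "\<dots> \<le> 2 ^ ?w" by (rule pow) (simp add: c_def D_def)
      finally show ?thesis .
    qed
    have mem: "s n div ?w = S ?L" using c L by (simp add: s_def)
    \<comment> \<open>This matching depends on the instance only, not on query, memory or tape, and
      is the single solution behind all answers.\<close>
    let ?M = "greedy (colour D ?L nbr 3)"
    let ?y = "\<lambda>q :: nat list. {q ! 0, q ! 1} \<in> ?M"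
    have maximal: "maximal_matching E ?M"
    proof (rule maximal_greedy)
      fix x m assume "x \<in> edge_ids" "m < 2 * d" "nbr m x \<noteq> x"
      then show "colour D ?L nbr 3 (nbr m x) \<noteq> colour D ?L nbr 3 x"
        unfolding D_def by (intro colour_proper[OF _ L n]) auto
    qed
    have run: "\<exists>M'. run (program d C) ?w (S ?L) ?X R (T ?L) (0, put_query q M) = Some M' \<and>
        (M' 0 \<noteq> 0 \<longleftrightarrow> ?y q)" if query: "q \<in> {[u, v] |u v. {u, v} \<in> E}" for q M R
    proof -
      obtain u v where q: "q = [u, v]" "{u, v} \<in> E" using query by blast
      have n2: "2 \<le> n" using edge_bounds[OF q(2)] by simp
      have dpos: "0 < d"
        using adj_ex[OF q(2)] length_adj[of u] edge_bounds[OF q(2)] by fastforce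
      have width: "2 * width D ?L r < ?w" if "r \<le> 3" for r
      proof -
        have "width D ?L r \<le> (2 * D) ^ r * (2 * ?L)" by (rule width_le)
        also have "\<dots> \<le> (2 * D) ^ 3 * (2 * ?L)"
          using that dpos by (intro mult_right_mono power_increasing) (simp_all add: D_def)
        finally have "2 * width D ?L r \<le> (4 * (2 * D) ^ 3) * ?L" by (simp add: ac_simps)
        also have "\<dots> < ?w" using L by (intro mult_strict_right_mono) (simp_all add: c_def)
        finally show ?thesis .
      qed
      interpret machine ?w "S ?L" R n d E A C u v
      proof unfold_locales
        have "S ?L \<le> (31 + D * C) * ?L" using L by (simp add: S_def algebra_simps)
        also have "\<dots> < 2 ^ ?w" by (rule wlt) (use C(1) in \<open>simp add: c_def\<close>)
        finally show "base + 2 * d * (C * ?L) + 1 < 2 ^ ?w" by (simp add: S_def D_def)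
        show "base + 1 < ?w"
          using L by (cases ?L) (simp_all add: c_def)
        show "C < 2 ^ ?w"
        proof -
          have "C \<le> C * ?L" using L by simp
          also have "\<dots> < 2 ^ ?w" by (rule wlt) (simp add: c_def)
          finally show ?thesis .
        qed
        have "n * n < 2 ^ ?L * 2 ^ ?L" using n by (intro mult_strict_mono) simp_all
        also have "\<dots> = 2 ^ (2 * ?L)" by (simp add: mult_2 power_add)
        also have "\<dots> \<le> 2 ^ ?w" by (rule pow) (simp add: c_def)
        finally show nn: "n * n < 2 ^ ?w" .
        have "2 * n \<le> n * n" using n2 by (rule mult_right_mono) simp
        with nn show "2 * n < 2 ^ ?w" by linarith
        show "2 * d < 2 ^ ?w"
        proof -
          have "2 * d \<le> D * ?L" using L by (simp add: D_def)
          also have "\<dots> < 2 ^ ?w" by (rule wlt) (simp add: c_def)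
          finally show ?thesis .
        qed
        fix r :: nat assume "r \<le> 3"
        from width[OF this] show "width (2 * d) ?L r < ?w" by (simp add: D_def)
        from width[OF \<open>r \<le> 3\<close>] less_exp[of ?w] show "2 * width (2 * d) ?L r < 2 ^ ?w"
          unfolding D_def by linarith
      qed (use q(2) lenX C(2)[OF L dpos] in \<open>simp_all add: S_def D_def\<close>)
      show ?thesis
        using run_program[of "put_query q M"] final_iff
        by (simp add: q put_query_def T_def D_def)
    qed
    have ans: "answers (program d C) ?w (S ?L) ?X R (T ?L) (\<lambda>_. 0) qs = Some (map ?y qs)"
      if "qs \<in> lists {[u, v] |u v. {u, v} \<in> E}" for R qs
      by (rule answers_eq_map[OF run that])
    have "\<exists>y\<in>solutions (maximal_matching_problem d) x.
        \<forall>qs\<in>lists (queries (maximal_matching_problem d) x).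
          answers (program d C) ?w (S ?L) ?X R (T ?L) (\<lambda>_. 0) qs = Some (map y qs)" for R
    proof (rule bexI[of _ ?y])
      show "?y \<in> solutions (maximal_matching_problem d) x"
        using maximal by (auto simp: maximal_matching_problem_def xeq)
    qed (use ans in \<open>simp add: maximal_matching_problem_def xeq\<close>)
    then have all: "{R. \<exists>y\<in>solutions (maximal_matching_problem d) x.
        \<forall>qs\<in>lists (queries (maximal_matching_problem d) x).
          answers (program d C) ?w (S ?L) ?X R (T ?L) (\<lambda>_. 0) qs = Some (map y qs)} = UNIV"
      by blast
    have X: "length ?X \<le> 2 ^ ?w" "set ?X \<subseteq> {..<2 ^ ?w}"
      using lenX set_encode by fastforce+
    have sel: "instance_size (maximal_matching_problem d) x = n"
      "input_words (maximal_matching_problem d) x = ?X"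
      "queries (maximal_matching_problem d) x = {[u, v] |u v. {u, v} \<in> E}"
      by (simp_all add: maximal_matching_problem_def xeq)
    show "let n = instance_size (maximal_matching_problem d) x; w = c * floorlog 2 n;
            X = input_words (maximal_matching_problem d) x;
            ans = (\<lambda>R qs. answers (program d C) w (s n div w) X R (t n) (\<lambda>_. 0) qs)
        in length X \<le> 2 ^ w \<and> set X \<subseteq> {..<2 ^ w} \<and>
           (\<forall>R \<in> set_pmf (random_tape w). \<forall>qs \<in> lists (queries (maximal_matching_problem d) x). ans R qs \<noteq> None) \<and>
           measure_pmf.prob (random_tape w)
             {R. \<exists>y \<in> solutions (maximal_matching_problem d) x.
               \<forall>qs \<in> lists (queries (maximal_matching_problem d) x). ans R qs = Some (map y qs)}
             \<ge> 1 - 1 / real n"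
      unfolding Let_def sel(1,2) mem t_def all
      using X ans by (simp add: sel(3))
  qed
  with t s show ?thesis by blast
qed

end
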